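(* Let $\pi=(3,2,1)$ be the permutation of $\{1,2,3\}$ given by $\pi(j)=4-j$. Then for Lebesgue almost every $\lambda\in\Lambda_3$ the interval exchange transformation $T_{(\lambda,\pi)}$ is whirly.
   Context: $\Lambda_3\subset\mathbb{R}^3$ is the cone of vectors $\lambda=(\lambda_1,\lambda_2,\lambda_3)$ with all $\lambda_i>0$; $|\lambda|=\lambda_1+\lambda_2+\lambda_3$, $\beta_0=0$, $\beta_i=\sum_{j\le i}\lambda_j$. The interval exchange transformation $T=T_{(\lambda,\pi)}:[0,|\lambda|)\to[0,|\lambda|)$ is defined by $T(x)=x-\beta_{i-1}+\sum_{j=1}^{\pi(i)-1}\lambda_{\pi^{-1}(j)}$ for $x\in[\beta_{i-1},\beta_i)$, $1\le i\le 3$ (it sends the $i$-th interval to the $\pi(i)$-th position). It is regarded as an invertible measure-preserving transformation of the probability space $[0,|\lambda|)$ with Borel $\sigma$-algebra and normalized Lebesgue measure $\mu$. For a standard probability space $(X,\mathcal{B},\mu)$, let $G=\mathrm{Aut}(X,\mathcal{B},\mu)$ be its group of automorphisms with the weak topology, generated by the metric $d(S,T)=\sum_{n\ge1}2^{-n}\mu(SE_n\,\triangle\,TE_n)$, where $(E_n)$ is a fixed countable family of measurable sets generating $\mathcal{B}$. For $\epsilon>0$, $U_\epsilon=\{S\in G: d(S,\mathrm{Id})<\epsilon\}$. $T$ is rigid if $T^{n_k}\to\mathrm{Id}$ weakly for some sequence $n_k\to\infty$. A rigid system $(X,\mathcal{B},\mu,T)$ is whirly if for every $\epsilon>0$ and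 all $E,F\in\mathcal{B}$ with $\mu(E),\mu(F)>0$ there exists an integer $n$ such that $T^n\in U_\epsilon$ and $\mu(T^nE\cap F)>0$. *)

theory Defs
  imports "HOL-Probability.Probability"
begin

section \<open>Automorphisms, the weak topology, rigidity and whirliness\<close>

text \<open>
  Automorphisms are represented by bimeasurable measure preserving bijections of the
  whole space; they are not quotiented by equality almost everywhere. Only their values on
  \<open>space M\<close> matter.
\<close>

definition Aut :: "'a measure \<Rightarrow> ('a \<Rightarrow> 'a) set" where
  "Aut M = {S. bij_betw S (space M) (space M)
               \<and> S \<in> measurable M M
               \<and> inv_into (space M) S \<in> measurable M M
               \<and> (\<forall>A\<in>sets M. emeasure M (S -` A \<inter> space M) = emeasure M A)}"

definition int_iter :: "'a measure \<Rightarrow> ('a \<Rightarrow> 'a) \<Rightarrow> int \<Rightarrow> 'a \<Rightarrow> 'a" where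
  "int_iter M T n =
     (if 0 \<le> n then T ^^ nat n else inv_into (space M) T ^^ nat (- n))"

definition generating_family :: "'a measure \<Rightarrow> (nat \<Rightarrow> 'a set) \<Rightarrow> bool" where
  "generating_family M E \<longleftrightarrow> sets M = sigma_sets (space M) (range E)"

text \<open>
  The family is indexed from \<open>0\<close>, so its \<open>n\<close>-th member has weight \<open>(1 / 2) ^ (n + 1)\<close>.
  On point maps this is only a pseudometric: it vanishes exactly on pairs that agree
  almost everywhere (on a standard space, for a generating family).
\<close>

definition weak_dist ::
  "'a measure \<Rightarrow> (nat \<Rightarrow> 'a set) \<Rightarrow> ('a \<Rightarrow> 'a) \<Rightarrow> ('a \<Rightarrow> 'a) \<Rightarrow> real" where
  "weak_dist M E S T =
     (\<Sum>n. (1 / 2) ^ Suc n * measure M (sym_diff (S ` E n) (T ` E n)))"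

definition weak_nbhd ::
  "'a measure \<Rightarrow> (nat \<Rightarrow> 'a set) \<Rightarrow> real \<Rightarrow> ('a \<Rightarrow> 'a) set" where
  "weak_nbhd M E \<epsilon> = {S \<in> Aut M. weak_dist M E S id < \<epsilon>}"

definition rigid ::
  "'a measure \<Rightarrow> (nat \<Rightarrow> 'a set) \<Rightarrow> ('a \<Rightarrow> 'a) \<Rightarrow> bool" where
  "rigid M E T \<longleftrightarrow>
     prob_space M \<and> T \<in> Aut M \<and>
     (\<exists>n :: nat \<Rightarrow> int. filterlim n at_top sequentially
        \<and> (\<lambda>k. weak_dist M E (int_iter M T (n k)) id) \<longlonglongrightarrow> 0)"

definition whirly ::
  "'a measure \<Rightarrow> (nat \<Rightarrow> 'a set) \<Rightarrow> ('a \<Rightarrow> 'a) \<Rightarrow> bool" where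
  "whirly M E T \<longleftrightarrow>
     rigid M E T \<and>
     (\<forall>\<epsilon>>0. \<forall>A\<in>sets M. \<forall>B\<in>sets M. measure M A > 0 \<and> measure M B > 0 \<longrightarrow>
        (\<exists>n :: int. int_iter M T n \<in> weak_nbhd M E \<epsilon>
                    \<and> measure M (int_iter M T n ` A \<inter> B) > 0))"

section \<open>Interval exchange transformations of three intervals\<close>

text \<open>
  The coordinates are \<open>l $ 1\<close>, \<open>l $ 2\<close>, \<open>l $ 3\<close>. The index type \<open>3\<close> is arithmetic modulo
  \<open>3\<close>, so indices are taken in \<open>{1..3}\<close> as natural numbers and cast by \<open>of_nat\<close>.
\<close>

definition len :: "real ^ 3 \<Rightarrow> nat \<Rightarrow> real" where
  "len l i = l $ of_nat i"

definition Lambda3 :: "(real ^ 3) set" where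
  "Lambda3 = {l. \<forall>i\<in>{1..3}. len l i > 0}"

definition total_len :: "real ^ 3 \<Rightarrow> real" where
  "total_len l = (\<Sum>i=1..3. len l i)"

definition beta :: "real ^ 3 \<Rightarrow> nat \<Rightarrow> real" where
  "beta l i = (\<Sum>j=1..i. len l j)"

text \<open>Only the values on \<open>[0, total_len l)\<close> are meaningful.\<close>

definition iet :: "real ^ 3 \<Rightarrow> (nat \<Rightarrow> nat) \<Rightarrow> real \<Rightarrow> real" where
  "iet l p x =
     (let i = (THE i. i \<in> {1..3} \<and> x \<in> {beta l (i - 1)..<beta l i})
      in x - beta l (i - 1) + (\<Sum>j=1..p i - 1. len l (inv_into {1..3} p j)))"

definition iet_space :: "real ^ 3 \<Rightarrow> real measure" where
  "iet_space l =
     (let X = {0..<total_len l} in uniform_measure (restrict_space lborel X) X)"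

end

theory Submission
  imports Defs
begin

text \<open>
  \<open>T\<close> is the first return map to \<open>[0, s)\<close>, \<open>s = l1 + l2 + l3\<close>, of the rotation by
  \<open>\<alpha> = l2 + l3\<close> on a circle of length \<open>L = s + l2\<close>. Let \<open>p / q\<close> be a very good approximation
  of \<open>\<alpha> / L\<close>. An orbit segment of length \<open>q\<close> of the rotation is nearly closed and nearly equally
  spaced, so it meets \<open>[s, L)\<close> either \<open>K = \<lfloor>q * l2 / L\<rfloor>\<close> or \<open>K + 1\<close> times, and the second case occurs
  on an almost \<open>L / q\<close>-periodic set of density about \<open>c = frac (q * l2 / L)\<close>. Hence
  \<open>T ^^ (q - K)\<close> is close to the identity outside that set and close to \<open>T\<close> on it. For almost every
  \<open>\<lambda>\<close> such \<open>q\<close> exist with \<open>c\<close> arbitrarily small, so near-identity powers of \<open>T\<close> imitate \<open>T\<close> on an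
  equidistributed set of positive measure. Composing them imitates every \<open>T ^^ m\<close>, and ergodicity
  carries any set of positive measure to any other.
\<close>

section \<open>Porous sets and translations\<close>

text \<open>The circle is longer than \<open>[0, s)\<close> by \<open>l2\<close> because the middle
  interval of the exchange needs two steps of the rotation and the outer ones need one. The number
  of visits to \<open>[s, L)\<close> is a difference of two floor sums along the orbit. For a
  rational rotation such a sum depends on its starting point \<open>x\<close> only through
  \<lfloor>q * x\<rfloor>, hence the two possible values.

  The offset \<open>c\<close> is under two opposite demands. It must be small, since
  \<open>T ^^ n\<close> disturbs given sets mainly on the displaced points. It must also dominate
  the approximation error, since the count is uncontrolled near its jumps and these margins must not
  swallow the displaced points. So the pair (\<alpha> / L, l2 / L) has to satisfy a joint condition
  at the same denominators. Choosing the first number first fixes an infinite set of good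
  denominators; almost every second number then has the wanted fractional part along that set.

  Equidistribution of the displaced points is needed only inside one fixed set at a time. That set
  is almost invariant under translations by less than one period, and a bounded number of such
  translations carries the displaced points over everything.\<close>

lemma porous_lmeasurable_negligible:
  fixes S :: "'a::euclidean_space set"
  assumes S: "S \<in> lmeasurable" and "\<kappa> > 0"
    and hole: "\<And>x d. \<lbrakk>x \<in> S; d > 0\<rbrakk> \<Longrightarrow> \<exists>r y. 0 < r \<and> r < d \<and> cball y (\<kappa> * r) \<subseteq> cball x r - S"
  shows "negligible S"
proof (rule ccontr)
  assume neg: "\<not> negligible S"
  define e where "e = \<kappa> ^ DIM('a) * measure lebesgue S"
  have "measure lebesgue S > 0"
    using neg S by (simp add: negligible_iff_measure zero_less_measure_iff)
  then have "e > 0"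
    using \<open>\<kappa> > 0\<close> by (simp add: e_def)
  then obtain U where U: "open U" "S \<subseteq> U" "U - S \<in> lmeasurable" "emeasure lebesgue (U - S) < ennreal e"
    using S sets_lebesgue_outer_open by blast
  \<comment> \<open>Triples of centre, radius and centre of the hole. Disjoint balls from this
    Vitali cover fill almost all of \<open>S\<close>, so their holes have total measure at least
    \<open>e\<close>; but the holes lie in \<open>U - S\<close>, which has measure below
    \<open>e\<close>.\<close>
  define K where "K = {(x, r, y). x \<in> S \<and> 0 < r \<and> cball x r \<subseteq> U \<and> cball y (\<kappa> * r) \<subseteq> cball x r - S}"
  let ?r = "\<lambda>i::'a \<times> real \<times> 'a. fst (snd i)"
  have pos: "0 < ?r i" if "i \<in> K" for i
    using that by (auto simp: K_def)
  have ex: "\<exists>i. i \<in> K \<and> x \<in> cball (fst i) (?r i) \<and> ?r i < d" if x: "x \<in> S" and d: "0 < d" for x d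
  proof -
    obtain d' where d': "d' > 0" "cball x d' \<subseteq> U"
      using U x open_contains_cball by blast
    obtain r y where r: "0 < r" "r < min d d'" "cball y (\<kappa> * r) \<subseteq> cball x r - S"
      using hole[OF x, of "min d d'"] d d' by auto
    have "cball x r \<subseteq> U"
      using d' r subset_cball[of r d' x] by auto
    then have "(x, r, y) \<in> K"
      using r x by (simp add: K_def)
    moreover have "x \<in> cball (fst (x, r, y)) (?r (x, r, y)) \<and> ?r (x, r, y) < d"
      using r by simp
    ultimately show ?thesis
      by blast
  qed
  obtain C where C: "countable C" "C \<subseteq> K"
     "pairwise (\<lambda>i j. disjnt (cball (fst i) (?r i)) (cball (fst j) (?r j))) C"
     "negligible (S - (\<Union>i \<in> C. cball (fst i) (?r i)))"
    by (rule Vitali_covering_theorem_cballs[OF pos ex]) (assumption | rule that)+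
  define B where "B = (\<lambda>i. cball (fst i) (?r i))"
  define H where "H = (\<lambda>i. cball (snd (snd i)) (\<kappa> * ?r i) :: 'a set)"
  have HB: "H i \<subseteq> B i - S" "B i \<subseteq> U" if "i \<in> C" for i
    using that C(2) by (auto simp: K_def H_def B_def subset_eq)
  have disjB: "disjoint_family_on B C"
    using C(3) by (auto simp: disjoint_family_on_def pairwise_def disjnt_def B_def)
  then have disjH: "disjoint_family_on H C"
    using HB unfolding disjoint_family_on_def by blast
  have emH: "emeasure lebesgue (H i) = ennreal (\<kappa> ^ DIM('a)) * emeasure lebesgue (B i)" if "i \<in> C" for i
  proof -
    obtain x r y where i: "i = (x, r, y)" by (cases i) auto
    then have "r > 0" using that C(2) by (auto simp: K_def)
    then show ?thesis
      using \<open>\<kappa> > 0\<close>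
      by (simp add: H_def B_def i emeasure_cball power_mult_distrib ennreal_mult' [symmetric] mult_ac)
  qed
  have "emeasure lebesgue S \<le> emeasure lebesgue ((\<Union>i\<in>C. B i) \<union> (S - (\<Union>i \<in> C. B i)))"
    using C S by (intro emeasure_mono) (auto simp: B_def intro!: sets.countable_UN'' sets.Un sets.Diff)
  also have "\<dots> = emeasure lebesgue (\<Union>i\<in>C. B i)"
    using C by (intro emeasure_Un_null_set) (auto simp: B_def negligible_iff_null_sets intro!: sets.countable_UN'')
  also have "\<dots> = (\<integral>\<^sup>+i. emeasure lebesgue (B i) \<partial>count_space C)"
    using C disjB by (intro emeasure_UN_countable) (auto simp: B_def)
  finally have SB: "emeasure lebesgue S \<le> (\<integral>\<^sup>+i. emeasure lebesgue (B i) \<partial>count_space C)" .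
  have "ennreal e = ennreal (\<kappa> ^ DIM('a)) * emeasure lebesgue S"
    using S \<open>\<kappa> > 0\<close> by (simp add: e_def ennreal_mult emeasure_eq_measure2)
  also have "\<dots> \<le> ennreal (\<kappa> ^ DIM('a)) * (\<integral>\<^sup>+i. emeasure lebesgue (B i) \<partial>count_space C)"
    by (intro mult_left_mono SB) auto
  also have "\<dots> = (\<integral>\<^sup>+i. emeasure lebesgue (H i) \<partial>count_space C)"
    by (subst nn_integral_cmult[symmetric]) (auto intro!: nn_integral_cong simp: emH)
  also have "\<dots> = emeasure lebesgue (\<Union>i\<in>C. H i)"
    using C disjH by (intro emeasure_UN_countable[symmetric]) (auto simp: H_def)
  also have "\<dots> \<le> emeasure lebesgue (U - S)"
    using HB U(3) by (intro emeasure_mono) blast+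
  finally show False
    using U(4) by simp
qed

lemma porous_negligible:
  fixes S :: "'a::euclidean_space set"
  assumes S: "S \<in> sets lebesgue" and "\<kappa> > 0"
    and hole: "\<And>x d. \<lbrakk>x \<in> S; d > 0\<rbrakk> \<Longrightarrow> \<exists>r y. 0 < r \<and> r < d \<and> cball y (\<kappa> * r) \<subseteq> cball x r - S"
  shows "negligible S"
  unfolding negligible_on_intervals[of S]
proof (intro allI)
  fix a b
  have "S \<inter> cbox a b \<in> lmeasurable"
    using S by (metis Int_commute fmeasurable_Int_fmeasurable lmeasurable_cbox)
  then show "negligible (S \<inter> cbox a b)"
  proof (rule porous_lmeasurable_negligible[OF _ \<open>\<kappa> > 0\<close>])
    fix x and d :: real assume "x \<in> S \<inter> cbox a b" "d > 0"
    then obtain r y where "0 < r" "r < d" "cball y (\<kappa> * r) \<subseteq> cball x r - S"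
      using hole by blast
    then show "\<exists>r y. 0 < r \<and> r < d \<and> cball y (\<kappa> * r) \<subseteq> cball x r - S \<inter> cbox a b"
      by blast
  qed
qed

section \<open>Borel sets of reals under translation\<close>

lemma emeasure_lborel_translate_vimage:
  fixes W :: "real set"
  assumes "W \<in> sets borel"
  shows "emeasure lborel {x. x + t \<in> W} = emeasure lborel W"
proof -
  have "emeasure lborel W = emeasure (distr lborel borel ((+) t)) W"
    by (simp only: lborel_distr_plus)
  also have "\<dots> = emeasure lborel {x. x + t \<in> W}"
    using assms by (subst emeasure_distr) (auto simp: vimage_def add.commute)
  finally show ?thesis ..
qed

text \<open>Squeeze \<open>A\<close> between a compact \<open>K\<close> and an open
  \<open>U\<close>. A shift shorter than the distance from \<open>K\<close> to the complement of
  \<open>U\<close> keeps \<open>K\<close> inside \<open>U\<close>, so a point leaving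
  \<open>A\<close> was in \<open>A - K\<close> or lands in \<open>U - A\<close>.\<close>

lemma measure_translate_diff_small:
  fixes A :: "real set"
  assumes A: "A \<in> sets borel" and "bounded A" and "\<epsilon> > 0"
  obtains d where "d > 0" "\<And>t. \<bar>t\<bar> < d \<Longrightarrow> measure lborel {x \<in> A. x + t \<notin> A} < \<epsilon>"
proof -
  have A': "A \<in> sets lebesgue" using A by auto
  obtain K where K: "closed K" "K \<subseteq> A" "A - K \<in> lmeasurable" "emeasure lebesgue (A - K) < ennreal (\<epsilon>/2)"
    using sets_lebesgue_inner_closed[OF A', of "\<epsilon>/2"] half_gt_zero[OF \<open>\<epsilon> > 0\<close>] by blast
  obtain U where U: "open U" "A \<subseteq> U" "U - A \<in> lmeasurable" "emeasure lebesgue (U - A) < ennreal (\<epsilon>/2)"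
    using sets_lebesgue_outer_open[OF A', of "\<epsilon>/2"] half_gt_zero[OF \<open>\<epsilon> > 0\<close>] by blast
  have "compact K" using K \<open>bounded A\<close> bounded_subset compact_eq_bounded_closed by blast
  then obtain d where d: "d > 0" "\<And>x y. \<lbrakk>x \<in> K; y \<in> - U\<rbrakk> \<Longrightarrow> d \<le> dist x y"
    using separate_compact_closed[of K "- U"] K U by blast
  have [measurable]: "U \<in> sets borel" "K \<in> sets borel" "A \<in> sets borel"
    using U K A by auto
  show ?thesis
  proof (rule that[OF d(1)])
    fix t :: real assume t: "\<bar>t\<bar> < d"
    let ?D = "{x \<in> A. x + t \<notin> A}" and ?V = "{x. x + t \<in> U - A}"
    have V: "?V \<in> sets borel" by measurable
    have "x + t \<in> U" if "x \<in> K" for x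
      using d(2)[OF that, of "x + t"] t by (auto simp: dist_real_def)
    then have "?D \<subseteq> (A - K) \<union> ?V" by blast
    then have "emeasure lborel ?D \<le> emeasure lborel ((A - K) \<union> ?V)"
      using V by (intro emeasure_mono) auto
    also have "\<dots> \<le> emeasure lborel (A - K) + emeasure lborel ?V"
      using V by (intro emeasure_subadditive) auto
    also have "emeasure lborel ?V = emeasure lborel (U - A)"
      by (rule emeasure_lborel_translate_vimage) simp
    also have "emeasure lborel (A - K) + emeasure lborel (U - A) < ennreal (\<epsilon>/2) + ennreal (\<epsilon>/2)"
      using K(4) U(4) by (intro add_strict_mono) auto
    also have "\<dots> = ennreal \<epsilon>"
      using \<open>\<epsilon> > 0\<close> by (simp flip: ennreal_plus)
    finally have D: "emeasure lborel ?D < ennreal \<epsilon>" .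
    then have "emeasure lborel ?D = ennreal (measure lborel ?D)"
      by (intro emeasure_eq_ennreal_measure) auto
    with D \<open>\<epsilon> > 0\<close> show "measure lborel ?D < \<epsilon>"
      by (simp add: ennreal_less_iff)
  qed
qed

text \<open>By Fubini the integral over \<open>t\<close> of the overlap is the product of the two
  measures, so the overlap cannot vanish for every \<open>t\<close>.\<close>

lemma positive_translate_overlap:
  fixes A B :: "real set"
  assumes [measurable]: "A \<in> sets borel" "B \<in> sets borel"
    and pos: "emeasure lborel A > 0" "emeasure lborel B > 0"
  shows "\<exists>t. emeasure lborel {x \<in> A. x + t \<in> B} > 0"
proof (rule ccontr)
  assume "\<not> ?thesis"
  then have z: "emeasure lborel {x \<in> A. x + t \<in> B} = 0" for t
    by (metis not_gr_zero)
  have "emeasure lborel B * emeasure lborel A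
      = (\<integral>\<^sup>+x. indicator A x * emeasure lborel B \<partial>lborel)"
    by (simp add: nn_integral_multc mult.commute)
  also have "\<dots> = (\<integral>\<^sup>+x. indicator A x * (\<integral>\<^sup>+t. indicator B (x + t) \<partial>lborel) \<partial>lborel)"
  proof (intro nn_integral_cong arg_cong2[where f="(*)"] refl)
    fix x :: real
    show "emeasure lborel B = (\<integral>\<^sup>+t. indicator B (x + t) \<partial>lborel)"
      using nn_integral_real_affine[of "indicator B" 1 x] by simp
  qed
  also have "\<dots> = (\<integral>\<^sup>+x. (\<integral>\<^sup>+t. indicator A x * indicator B (x + t) \<partial>lborel) \<partial>lborel)"
    by (subst nn_integral_cmult) auto
  also have "\<dots> = (\<integral>\<^sup>+t. (\<integral>\<^sup>+x. indicator A x * indicator B (x + t) \<partial>lborel) \<partial>lborel)"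
    by (rule lborel_pair.Fubini') measurable
  also have "\<dots> = (\<integral>\<^sup>+t. emeasure lborel {x \<in> A. x + t \<in> B} \<partial>lborel)"
  proof (intro nn_integral_cong)
    fix t :: real
    have "(\<integral>\<^sup>+x. indicator A x * indicator B (x + t) \<partial>lborel)
        = (\<integral>\<^sup>+x. indicator {x \<in> A. x + t \<in> B} x \<partial>lborel)"
      by (intro nn_integral_cong) (auto simp: indicator_def)
    then show "(\<integral>\<^sup>+x. indicator A x * indicator B (x + t) \<partial>lborel) = emeasure lborel {x \<in> A. x + t \<in> B}"
      by simp
  qed
  also have "\<dots> = 0"
    by (simp add: z)
  finally show False
    using pos by (simp add: zero_less_iff_neq_zero)
qed

section \<open>Diophantine approximation\<close>

text \<open>The offset \<open>frac (q * b)\<close>, which becomes the density of the set of displaced points, is arbitrarily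
  small, but more than four times the error of the approximation of \<open>a\<close>.\<close>

definition well_approx_pair :: "real \<Rightarrow> real \<Rightarrow> bool" where
  "well_approx_pair a b \<longleftrightarrow> a \<notin> \<rat> \<and>
     (\<forall>r\<ge>2. \<forall>Q. \<exists>q\<ge>Q. \<exists>p::int. q > 0 \<and> coprime p (int q) \<and>
        \<bar>a - p / q\<bar> < 1 / (8 * real r) / (real q)\<^sup>2 \<and>
        1 / (2 * real r) < frac (q * b) \<and> frac (q * b) < 1 / real r)"

lemma negligible_AE_lborel:
  fixes S :: "'a::euclidean_space set"
  assumes "negligible S" "S \<in> sets borel"
  shows "AE x in lborel. x \<notin> S"
  using assms by (intro AE_not_in) (simp add: negligible_iff_null_sets null_sets_completion_iff)

text \<open>Dirichlet's theorem provides infinitely many \<open>p / q\<close> within \<open>1 / q\<^sup>2\<close> of an irrational number.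
  So the numbers that eventually avoid the smaller balls of radius \<open>\<epsilon> / q\<^sup>2\<close> form a porous set.\<close>

lemma AE_coprime_approximations:
  fixes \<epsilon> :: real
  assumes \<epsilon>: "\<epsilon> > 0"
  shows "AE a in lborel. \<forall>Q. \<exists>q\<ge>Q. \<exists>p::int. q > 0 \<and> coprime p (int q) \<and> \<bar>a - p / q\<bar> < \<epsilon> / (real q)\<^sup>2"
proof -
  define P where "P q p \<longleftrightarrow> q > 0 \<and> coprime p (int q)" for q :: nat and p :: int
  define U where "U Q = (\<Union>q\<in>{Q..}. \<Union>p\<in>{p. P q p}. ball (of_int p / real q) (\<epsilon> / (real q)\<^sup>2))" for Q :: nat
  \<comment> \<open>The cap at 1 keeps the hole around \<open>h / q\<close> inside the ball around
    \<open>x\<close>: its centre is within \<open>1 / q\<^sup>2\<close> of \<open>x\<close> and its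
    radius \<open>e / (2 * q\<^sup>2)\<close> is no larger than that, while the ball has radius
    \<open>2 / q\<^sup>2\<close>.\<close>
  define e where "e = min \<epsilon> 1"
  have e: "0 < e" "e \<le> 1" "e \<le> \<epsilon>" using \<epsilon> by (auto simp: e_def)
  have "AE a in lborel. a \<notin> \<rat> \<union> - U Q" for Q
  proof -
    have Rats: "(\<rat> :: real set) \<in> null_sets lborel"
      using countable_rat by (rule countable_imp_null_set_lborel)
    have UQ: "open (U Q)"
      unfolding U_def by auto
    have borel: "- U Q - \<rat> \<in> sets borel"
      using UQ Rats by (intro sets.Diff) auto
    have "negligible (- U Q - \<rat>)"
    proof (rule porous_negligible[where \<kappa> = "e / 4"])
      show "- U Q - \<rat> \<in> sets lebesgue"
        using borel by simp
      fix x d :: real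
      assume x: "x \<in> - U Q - \<rat>" and "d > 0"
      have "infinite (approx_set x)"
        using x rational_iff_finite_approx_set by auto
      then obtain h k where hk: "(h, k) \<in> approx_set x" "k > max (int Q) \<lceil>2 / d\<rceil>"
        using infinite_approx_set by blast
      define q where "q = nat k"
      have k: "k = int q" "q > 0" "q \<ge> Q" "P q h" and q: "\<bar>x - h / q\<bar> < 1 / (real q)\<^sup>2"
        using hk by (auto simp: approx_set_def q_def P_def)
      have "2 / d < q"
        using hk(2) k(1) by (simp add: ceiling_less_iff)
      have "2 / (real q)\<^sup>2 \<le> 2 / q"
        using k(2) by (simp add: field_simps power2_eq_square)
      also have "\<dots> < d"
        using \<open>2 / d < q\<close> \<open>d > 0\<close> k(2) by (simp add: field_simps)
      finally have rd: "2 / (real q)\<^sup>2 < d" .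
      have pos: "0 < 1 / (real q)\<^sup>2" using k(2) by simp
      have "cball (of_int h / real q) (e / 4 * (2 / (real q)\<^sup>2)) \<subseteq> cball x (2 / (real q)\<^sup>2)"
      proof
        fix y assume "y \<in> cball (of_int h / real q) (e / 4 * (2 / (real q)\<^sup>2))"
        then have "\<bar>h / q - y\<bar> \<le> (e / 2) * (1 / (real q)\<^sup>2)"
          by (simp add: dist_real_def)
        also have "\<dots> \<le> 1 * (1 / (real q)\<^sup>2)"
          using e pos by (intro mult_right_mono) auto
        finally show "y \<in> cball x (2 / (real q)\<^sup>2)"
          using q by (simp add: dist_real_def)
      qed
      moreover have "cball (of_int h / real q) (e / 4 * (2 / (real q)\<^sup>2)) \<subseteq> U Q"
      proof -
        have "e / 4 * (2 / (real q)\<^sup>2) < \<epsilon> / (real q)\<^sup>2"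
          using e k(2) by (simp add: field_simps)
        then have "cball (of_int h / real q) (e / 4 * (2 / (real q)\<^sup>2))
            \<subseteq> ball (of_int h / real q) (\<epsilon> / (real q)\<^sup>2)"
          by auto
        also have "\<dots> \<subseteq> U Q"
          using k(3,4) by (auto simp: U_def)
        finally show ?thesis .
      qed
      ultimately show "\<exists>r y. 0 < r \<and> r < d \<and> cball y (e / 4 * r) \<subseteq> cball x r - (- U Q - \<rat>)"
        using rd pos by (intro exI[of _ "2 / (real q)\<^sup>2"] exI[of _ "of_int h / real q"]) auto
    qed (use e in auto)
    then have "AE a in lborel. a \<notin> - U Q - \<rat>"
      using borel by (rule negligible_AE_lborel)
    moreover have "AE a in lborel. a \<notin> (\<rat> :: real set)"
      using Rats by (rule AE_not_in)
    ultimately show ?thesis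
      by eventually_elim auto
  qed
  then have "AE a in lborel. \<forall>Q. a \<notin> \<rat> \<union> - U Q"
    by (simp only: AE_all_countable) blast
  then show ?thesis
  proof eventually_elim
    case (elim a)
    show ?case
    proof
      fix Q
      have "a \<in> U Q" using elim by auto
      then show "\<exists>q\<ge>Q. \<exists>p::int. q > 0 \<and> coprime p (int q) \<and> \<bar>a - p / q\<bar> < \<epsilon> / (real q)\<^sup>2"
        by (fastforce simp: U_def P_def dist_real_def abs_minus_commute)
    qed
  qed
qed

lemma borel_measurable_frac [measurable]: "(frac :: real \<Rightarrow> real) \<in> borel_measurable borel"
  unfolding frac_def[abs_def] by measurable

text \<open>In each period of length \<open>1 / q\<close> the good points contain an interval of
  length \<open>(v - u) / q\<close>, so the points missing the window for all large \<open>q\<close>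
  in \<open>K\<close> form a porous set. The set \<open>K\<close> does not depend on
  \<open>b\<close>, which lets it be the set of good denominators of another number.\<close>

lemma AE_frac_multiples_mem:
  fixes u v :: real and K :: "nat set"
  assumes K: "infinite K" and uv: "0 \<le> u" "u < v" "v \<le> 1"
  shows "AE b in lborel. \<forall>Q. \<exists>q\<ge>Q. q \<in> K \<and> u < frac (q * b) \<and> frac (q * b) < v"
proof -
  have "AE b in lborel. \<exists>q\<ge>Q. q \<in> K \<and> u < frac (q * b) \<and> frac (q * b) < v" for Q
  proof -
    define S where "S = {b::real. \<not> (\<exists>q\<ge>Q. q \<in> K \<and> u < frac (q * b) \<and> frac (q * b) < v)}"
    have borel: "S \<in> sets borel"
      unfolding S_def by measurable
    have "negligible S"
    proof (rule porous_negligible[where \<kappa> = "(v - u) / 4"])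
      show "S \<in> sets lebesgue"
        using borel by simp
      fix x d :: real
      assume "x \<in> S" "d > 0"
      obtain N :: nat where N: "1 / d < N"
        using reals_Archimedean2 by blast
      obtain q where q: "q \<in> K" "q > max N Q"
        using K by (meson infinite_nat_iff_unbounded)
      have qpos: "real q > 0" using q by simp
      have "1 / d < q" using N q by simp
      then have qd: "1 / q < d"
        using qpos \<open>d > 0\<close> by (simp add: field_simps)
      \<comment> \<open>The centre of the window in the period that contains \<open>x\<close>; the
        hole is the middle half of that window.\<close>
      define y where "y = (\<lfloor>q * x\<rfloor> + (u + v) / 2) / q"
      have "z \<in> cball x (1 / q) \<and> z \<notin> S" if z: "z \<in> cball y ((v - u) / 4 * (1 / q))" for z
      proof
        define w where "w = q * z - \<lfloor>q * x\<rfloor>"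
        have "\<bar>q * z - q * y\<bar> = q * \<bar>y - z\<bar>"
          using qpos by (metis abs_minus_commute abs_mult abs_of_pos right_diff_distrib)
        also have "\<dots> \<le> q * ((v - u) / 4 * (1 / q))"
          using z qpos by (intro mult_left_mono) (auto simp: dist_real_def)
        also have "\<dots> = (v - u) / 4"
          using qpos by simp
        finally have "\<bar>q * z - q * y\<bar> \<le> (v - u) / 4" .
        moreover have "q * y = \<lfloor>q * x\<rfloor> + (u + v) / 2"
          using qpos by (simp add: y_def)
        ultimately have near: "\<bar>w - (u + v) / 2\<bar> \<le> (v - u) / 4"
          by (simp only: w_def diff_diff_eq)
        have "(u + v) / 2 - (v - u) / 4 \<le> w" "w \<le> (u + v) / 2 + (v - u) / 4"
          using near by (simp_all only: abs_le_iff diff_le_eq minus_diff_eq) (simp_all add: algebra_simps)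
        moreover have "u < (u + v) / 2 - (v - u) / 4" "(u + v) / 2 + (v - u) / 4 < v"
          using uv by (simp_all add: field_simps)
        ultimately have w: "u < w" "w < v"
          by (auto intro: less_le_trans le_less_trans)
        then have "frac (q * z) = w"
          using uv by (subst frac_unique_iff) (auto simp: w_def)
        then show "z \<notin> S"
          using w q unfolding S_def by (auto intro!: exI[of _ q])
        have "\<bar>q * x - q * z\<bar> \<le> 1"
          using w uv unfolding w_def by linarith
        then have "q * \<bar>x - z\<bar> \<le> 1"
          using qpos by (metis abs_mult abs_of_pos right_diff_distrib)
        then show "z \<in> cball x (1 / q)"
          using qpos by (simp add: dist_real_def field_simps)
      qed
      then have "cball y ((v - u) / 4 * (1 / q)) \<subseteq> cball x (1 / q) - S"
        by blast
      then show "\<exists>r y. 0 < r \<and> r < d \<and> cball y ((v - u) / 4 * r) \<subseteq> cball x r - S"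
        using qpos qd by (intro exI[of _ "1 / q"] exI[of _ y]) auto
    qed (use uv in auto)
    then have "AE b in lborel. b \<notin> S"
      using borel by (rule negligible_AE_lborel)
    then show ?thesis
      by (simp only: S_def mem_Collect_eq not_not)
  qed
  then show ?thesis
    by (simp add: AE_all_countable)
qed

text \<open>The quantifiers are nested because the denominators are determined by \<open>a\<close>
  alone; once \<open>a\<close> is fixed they form a fixed infinite set to which
  \<open>AE_frac_multiples_mem\<close> applies.\<close>

lemma AE_AE_well_approx_pair: "AE a in lborel. AE b in lborel. well_approx_pair a b"
proof -
  define P where "P r q a \<longleftrightarrow> (\<exists>p::int. q > 0 \<and> coprime p (int q) \<and> \<bar>a - p / q\<bar> < 1 / (8 * real r) / (real q)\<^sup>2)"
    for r q :: nat and a :: real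
  have approx: "AE a in lborel. \<forall>Q. \<exists>q\<ge>Q. P r q a" if "r \<ge> 2" for r
    using AE_coprime_approximations[of "1 / (8 * real r)"] that by (simp add: P_def)
  have "AE a in lborel. \<forall>r. r \<ge> 2 \<longrightarrow> (\<forall>Q. \<exists>q\<ge>Q. P r q a)"
    by (subst AE_all_countable, intro allI AE_impI) (rule approx)
  moreover have "AE a in lborel. a \<notin> (\<rat> :: real set)"
    using countable_rat by (intro AE_not_in countable_imp_null_set_lborel)
  ultimately show ?thesis
  proof eventually_elim
    case (elim a)
    have mult: "AE b in lborel. \<forall>Q. \<exists>q\<ge>Q. q \<in> {q. P r q a} \<and> 1 / (2 * real r) < frac (q * b) \<and> frac (q * b) < 1 / real r"
      if "r \<ge> 2" for r
    proof (rule AE_frac_multiples_mem)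
      show "infinite {q. P r q a}"
        using elim that unfolding infinite_nat_iff_unbounded_le by simp
    qed (use that in \<open>auto simp: field_simps\<close>)
    have "AE b in lborel. \<forall>r. r \<ge> 2 \<longrightarrow>
        (\<forall>Q. \<exists>q\<ge>Q. q \<in> {q. P r q a} \<and> 1 / (2 * real r) < frac (q * b) \<and> frac (q * b) < 1 / real r)"
      by (subst AE_all_countable, intro allI AE_impI) (rule mult)
    then show ?case
    proof eventually_elim
      case (elim b)
      then show ?case
        using \<open>a \<notin> \<rat>\<close> unfolding well_approx_pair_def P_def by blast
    qed
  qed
qed

lemma measurable_well_approx_pair [measurable]:
  "Measurable.pred (borel \<Otimes>\<^sub>M borel) (\<lambda>z. well_approx_pair (fst z) (snd z))"
proof -
  have [measurable]: "(\<rat> :: real set) \<in> sets borel"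
    using countable_rat by (rule countable_imp_null_set_lborel[THEN null_setsD2, simplified])
  show ?thesis
    unfolding well_approx_pair_def by measurable
qed

text \<open>The free third coordinate stands for the circumference \<open>L\<close>, so that these
  triples have the dimension of the length vectors and null sets can be carried over to
  them.\<close>

lemma negligible_not_well_approx_pair:
  "negligible {z :: (real \<times> real) \<times> real. \<not> well_approx_pair (fst (fst z)) (snd (fst z))}"
proof -
  let ?P = "\<lambda>z. well_approx_pair (fst z) (snd z)"
  have P [measurable]: "Measurable.pred (borel :: (real \<times> real) measure) ?P"
    using measurable_well_approx_pair by (simp add: borel_prod)
  have "AE z in (lborel :: (real \<times> real) measure). ?P z"
    unfolding lborel_prod[symmetric]
  proof (rule lborel_pair.AE_pair_measure)
    show "{z \<in> space (lborel \<Otimes>\<^sub>M lborel). ?P z} \<in> sets (lborel \<Otimes>\<^sub>M lborel)"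
      using measurable_well_approx_pair by (simp add: pred_def space_pair_measure)
  qed (simp add: AE_AE_well_approx_pair)
  have triple: "Measurable.pred ((borel :: (real \<times> real) measure) \<Otimes>\<^sub>M (borel :: real measure)) (\<lambda>z. ?P (fst z))"
    by (rule measurable_compose[OF measurable_fst P])
  have "AE z in (lborel :: ((real \<times> real) \<times> real) measure). ?P (fst z)"
    unfolding lborel_prod[where 'a="real \<times> real" and 'b=real, symmetric]
  proof (rule lborel_pair.AE_pair_measure)
    show "{z \<in> space (lborel \<Otimes>\<^sub>M lborel). ?P (fst z)}
        \<in> sets ((lborel :: (real \<times> real) measure) \<Otimes>\<^sub>M (lborel :: real measure))"
      using triple by (simp add: pred_def space_pair_measure)
    show "AE z in (lborel :: (real \<times> real) measure). AE L in (lborel :: real measure). ?P (fst (z, L))"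
      using \<open>AE z in lborel. ?P z\<close> by eventually_elim simp
  qed
  moreover have "{z. \<not> ?P (fst z)} \<in> sets (lborel :: ((real \<times> real) \<times> real) measure)"
    using triple by (simp add: borel_prod flip: pred_def)
  ultimately have "{z. \<not> ?P (fst z)} \<in> null_sets (lborel :: ((real \<times> real) \<times> real) measure)"
    by (subst AE_iff_null_sets) auto
  then show ?thesis
    by (simp add: negligible_iff_null_sets null_sets_completionI)
qed

section \<open>Floor sums along a rotation\<close>

text \<open>Raising \<open>m\<close> by 1 drops the first summand and appends one that is larger by
  1, so the sum grows exactly as \<open>m\<close> does, in both directions from 0.\<close>

lemma sum_div_shift:
  fixes m :: int and q :: nat
  assumes "q > 0"
  shows "(\<Sum>i<q. (m + int i) div int q) = m"
proof -
  define g where "g m = (\<Sum>i<q. (m + int i) div int q)" for m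
  have step: "g (m + 1) = g m + 1" for m
  proof -
    have "g (m + 1) = (\<Sum>i<q. (m + int (Suc i)) div int q)"
      by (simp add: g_def algebra_simps)
    then have "g (m + 1) + m div int q = (\<Sum>i<Suc q. (m + int i) div int q)"
      by (subst sum.lessThan_Suc_shift) simp
    also have "\<dots> = g m + (m div int q + 1)"
      using assms by (simp add: g_def)
    finally show ?thesis by simp
  qed
  have "g 0 = 0"
    by (simp add: g_def)
  have "g m = m"
  proof (induction m rule: int_induct[where k=0])
    case base show ?case by fact
  next
    case (step1 i) then show ?case using step by simp
  next
    case (step2 i) then show ?case using step[of "i - 1"] by simp
  qed
  then show ?thesis by (simp add: g_def)
qed

lemma hermite_identity:
  fixes x :: real and q :: nat
  assumes "q > 0"
  shows "(\<Sum>i<q. \<lfloor>x + real i / real q\<rfloor>) = \<lfloor>real q * x\<rfloor>"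
proof -
  have "\<lfloor>x + real i / real q\<rfloor> = (\<lfloor>real q * x\<rfloor> + int i) div int q" for i
  proof -
    have "x + real i / real q = (real q * x + real i) / real_of_int (int q)"
      using assms by (simp add: field_simps)
    then have "\<lfloor>x + real i / real q\<rfloor> = \<lfloor>real q * x + real i\<rfloor> div int q"
      by (metis floor_divide_real_eq_div of_nat_0_le_iff)
    then show ?thesis
      by (metis floor_add_int of_int_of_nat_eq)
  qed
  then show ?thesis
    using sum_div_shift[OF assms] by simp
qed

lemma bij_betw_mult_mod:
  fixes p :: int and q :: nat
  assumes "q > 0" "coprime p (int q)"
  shows "bij_betw (\<lambda>i. nat ((int i * p) mod int q)) {..<q} {..<q}"
proof -
  have inj: "inj_on (\<lambda>i. nat ((int i * p) mod int q)) {..<q}"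
  proof (rule inj_onI)
    fix i j assume ij: "i \<in> {..<q}" "j \<in> {..<q}"
      and "nat ((int i * p) mod int q) = nat ((int j * p) mod int q)"
    then have "(int i * p) mod int q = (int j * p) mod int q"
      using assms by (simp add: nat_eq_iff2 pos_mod_sign)
    then have "int q dvd (int i - int j) * p"
      by (metis left_diff_distrib mod_eq_dvd_iff)
    then have "int q dvd int i - int j"
      using assms by (simp add: coprime_commute coprime_dvd_mult_left_iff)
    then have "int i mod int q = int j mod int q"
      by (simp add: mod_eq_dvd_iff)
    then show "i = j"
      using ij by simp
  qed
  moreover have "(\<lambda>i. nat ((int i * p) mod int q)) ` {..<q} \<subseteq> {..<q}"
    using assms by (auto simp: nat_less_iff)
  ultimately show ?thesis
    by (simp add: bij_betw_def endo_inj_surj)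
qed

text \<open>The residues of \<open>i * p\<close> modulo \<open>q\<close> run through all of
  \<open>{..<q}\<close>, so up to integer parts independent of \<open>x\<close> this is Hermite's
  identity.\<close>

lemma sum_floor_rational_rotation:
  fixes x :: real and p :: int and q :: nat
  assumes "q > 0" "coprime p (int q)"
  shows "(\<Sum>i<q. \<lfloor>x + real i * (p / q)\<rfloor>) = \<lfloor>q * x\<rfloor> + (\<Sum>i<q. (int i * p) div int q)"
proof -
  have "\<lfloor>x + real i * (p / q)\<rfloor> = \<lfloor>x + real (nat ((int i * p) mod int q)) / q\<rfloor> + (int i * p) div int q" for i
  proof -
    have "real_of_int (int i * p) = real_of_int (int q * ((int i * p) div int q) + (int i * p) mod int q)"
      by simp
    also have "\<dots> = q * real_of_int ((int i * p) div int q) + real (nat ((int i * p) mod int q))"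
      using assms by (simp only: of_int_add of_int_mult) simp
    finally have "real i * (p / q) = ((int i * p) div int q) + real (nat ((int i * p) mod int q)) / q"
      using assms by (simp add: field_simps)
    then have "x + real i * (p / q)
        = (x + real (nat ((int i * p) mod int q)) / q) + real_of_int ((int i * p) div int q)"
      by linarith
    then show ?thesis
      by (simp only: floor_add_int)
  qed
  then have "(\<Sum>i<q. \<lfloor>x + real i * (p / q)\<rfloor>)
      = (\<Sum>i<q. \<lfloor>x + real (nat ((int i * p) mod int q)) / q\<rfloor>) + (\<Sum>i<q. (int i * p) div int q)"
    by (simp add: sum.distrib)
  also have "(\<Sum>i<q. \<lfloor>x + real (nat ((int i * p) mod int q)) / q\<rfloor>) = (\<Sum>i<q. \<lfloor>x + real i / q\<rfloor>)"
    using sum.reindex_bij_betw[OF bij_betw_mult_mod[OF assms], of "\<lambda>j. \<lfloor>x + real j / q\<rfloor>"] .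
  finally show ?thesis
    using assms by (simp add: hermite_identity)
qed

text \<open>Moving \<open>x\<close> by \<open>\<plusminus> \<delta> / q\<close> absorbs the error \<open>i * (a - p / q)\<close> and, under the hypothesis on the
  fractional part, does not change \<open>\<lfloor>q * x\<rfloor>\<close>.\<close>

lemma sum_floor_rotation:
  fixes x a \<delta> :: real and p :: int and q :: nat
  assumes q: "q > 0" "coprime p (int q)" and a: "\<bar>a - p / q\<bar> \<le> \<delta> / q\<^sup>2"
    and x: "\<delta> \<le> frac (q * x)" "frac (q * x) < 1 - \<delta>"
  shows "(\<Sum>i<q. \<lfloor>x + real i * a\<rfloor>) = \<lfloor>q * x\<rfloor> + (\<Sum>i<q. (int i * p) div int q)"
proof -
  have "0 \<le> \<delta> / q\<^sup>2"
    using a by linarith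
  then have \<delta>: "0 \<le> \<delta>"
    using q by (simp add: zero_le_divide_iff)
  have err: "\<bar>real i * a - real i * (p / q)\<bar> \<le> \<delta> / q" if "i < q" for i
  proof -
    have "\<bar>real i * a - real i * (p / q)\<bar> = real i * \<bar>a - p / q\<bar>"
      by (metis abs_mult abs_of_nat right_diff_distrib)
    also have "\<dots> \<le> q * (\<delta> / q\<^sup>2)"
      using that a by (intro mult_mono) auto
    finally show ?thesis
      using q by (simp add: power2_eq_square)
  qed
  have "(\<Sum>i<q. \<lfloor>x + real i * a\<rfloor>) \<le> (\<Sum>i<q. \<lfloor>(x + \<delta> / q) + real i * (p / q)\<rfloor>)"
    using err by (intro sum_mono floor_mono) (fastforce simp: abs_le_iff)
  also have "\<dots> = \<lfloor>q * x + \<delta>\<rfloor> + (\<Sum>i<q. (int i * p) div int q)"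
    using q sum_floor_rational_rotation[OF q, of "x + \<delta> / q"] by (simp add: distrib_left)
  also have "\<lfloor>q * x + \<delta>\<rfloor> = \<lfloor>q * x\<rfloor>"
    using x \<delta> by (intro floor_unique) (auto simp: frac_def)
  finally have le: "(\<Sum>i<q. \<lfloor>x + real i * a\<rfloor>) \<le> \<lfloor>q * x\<rfloor> + (\<Sum>i<q. (int i * p) div int q)" .
  have "\<lfloor>q * x\<rfloor> = \<lfloor>q * x - \<delta>\<rfloor>"
    using x \<delta> by (intro floor_unique[symmetric]) (auto simp: frac_def)
  then have "\<lfloor>q * x\<rfloor> + (\<Sum>i<q. (int i * p) div int q) = (\<Sum>i<q. \<lfloor>(x - \<delta> / q) + real i * (p / q)\<rfloor>)"
    using q sum_floor_rational_rotation[OF q, of "x - \<delta> / q"] by (simp add: right_diff_distrib)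
  also have "\<dots> \<le> (\<Sum>i<q. \<lfloor>x + real i * a\<rfloor>)"
    using err by (intro sum_mono floor_mono) (fastforce simp: abs_le_iff)
  finally show ?thesis
    using le by simp
qed

section \<open>Automorphisms and a criterion for whirliness\<close>

lemma vimage_inv_into_bij_betw:
  assumes "bij_betw S X X" "A \<subseteq> X"
  shows "inv_into X S -` A \<inter> X = S ` A"
proof
  show "inv_into X S -` A \<inter> X \<subseteq> S ` A"
    using assms by (auto simp: bij_betw_def) (metis f_inv_into_f image_eqI)
  show "S ` A \<subseteq> inv_into X S -` A \<inter> X"
    using assms by (force simp: bij_betw_def)
qed

lemma Aut_iff:
  "S \<in> Aut M \<longleftrightarrow> bij_betw S (space M) (space M) \<and> S \<in> measurable M M \<and>
     (\<forall>A\<in>sets M. S ` A \<in> sets M) \<and> (\<forall>A\<in>sets M. emeasure M (S -` A \<inter> space M) = emeasure M A)"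
proof -
  have "inv_into (space M) S \<in> measurable M M \<longleftrightarrow> (\<forall>A\<in>sets M. S ` A \<in> sets M)"
    if bij: "bij_betw S (space M) (space M)"
  proof -
    have "inv_into (space M) S \<in> space M \<rightarrow> space M"
      using bij_betw_inv_into[OF bij] by (auto simp: bij_betw_def)
    moreover have "inv_into (space M) S -` A \<inter> space M = S ` A" if "A \<in> sets M" for A
      using vimage_inv_into_bij_betw[OF bij sets.sets_into_space[OF that]] .
    ultimately show ?thesis
      by (simp add: measurable_def)
  qed
  then show ?thesis
    by (auto simp: Aut_def)
qed

lemma Aut_cong:
  assumes eq: "\<And>x. x \<in> space M \<Longrightarrow> S x = S' x"
  shows "S \<in> Aut M \<longleftrightarrow> S' \<in> Aut M"
proof -
  have "S ` A = S' ` A" if "A \<in> sets M" for A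
    using eq sets.sets_into_space[OF that] by (auto intro!: image_cong)
  moreover have "S -` A \<inter> space M = S' -` A \<inter> space M" for A
    using eq by auto
  ultimately show ?thesis
    using bij_betw_cong[of "space M" S S' "space M"] measurable_cong[of M S S' M] eq
    unfolding Aut_iff by simp
qed

lemma Aut_comp:
  assumes "S \<in> Aut M" "S' \<in> Aut M"
  shows "S \<circ> S' \<in> Aut M"
proof -
  have S: "bij_betw S (space M) (space M)" "S \<in> measurable M M" "\<And>A. A \<in> sets M \<Longrightarrow> S ` A \<in> sets M"
      "\<And>A. A \<in> sets M \<Longrightarrow> emeasure M (S -` A \<inter> space M) = emeasure M A"
    and S': "bij_betw S' (space M) (space M)" "S' \<in> measurable M M" "\<And>A. A \<in> sets M \<Longrightarrow> S' ` A \<in> sets M"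
      "\<And>A. A \<in> sets M \<Longrightarrow> emeasure M (S' -` A \<inter> space M) = emeasure M A"
    using assms by (auto simp: Aut_iff)
  show ?thesis
    unfolding Aut_iff
  proof (intro conjI ballI)
    fix A assume A: "A \<in> sets M"
    show "(S \<circ> S') ` A \<in> sets M"
      unfolding image_comp[symmetric] using A S(3) S'(3) by blast
    have "(S \<circ> S') -` A \<inter> space M = S' -` (S -` A \<inter> space M) \<inter> space M"
      using S'(1) by (auto simp: bij_betw_def)
    then show "emeasure M ((S \<circ> S') -` A \<inter> space M) = emeasure M A"
      using S(4)[OF A] S'(4)[OF measurable_sets[OF S(2) A]] by simp
  qed (fact bij_betw_trans[OF S'(1) S(1)] measurable_comp[OF S'(2) S(2)])+
qed

lemma Aut_pow: "S \<in> Aut M \<Longrightarrow> S ^^ n \<in> Aut M"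
proof (induction n)
  case 0
  have "id -` A \<inter> space M = A" if "A \<in> sets M" for A
    using sets.sets_into_space[OF that] by auto
  then show ?case
    by (auto simp: Aut_iff id_def[symmetric])
next
  case (Suc n)
  then show ?case
    unfolding funpow.simps by (intro Aut_comp)
qed

lemma int_iter_int [simp]: "int_iter M T (int n) = T ^^ n"
  by (simp add: int_iter_def)

text \<open>For powers of an automorphism the measure of this set is half that of the symmetric
  difference of \<open>A\<close> and its image, and it is subadditive in the exponent.\<close>

definition moved :: "('a \<Rightarrow> 'a) \<Rightarrow> 'a set \<Rightarrow> 'a set" where
  "moved S A = {x \<in> A. S x \<notin> A}"

locale automorphism = prob_space M for M :: "'a measure" +
  fixes T :: "'a \<Rightarrow> 'a"
  assumes Aut: "T \<in> Aut M"
begin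

lemma pow_mem: "x \<in> space M \<Longrightarrow> (T ^^ n) x \<in> space M"
  using Aut_pow[OF Aut, of n] by (auto simp: Aut_iff bij_betw_def)

lemma measurable_pow [measurable]: "T ^^ n \<in> measurable M M"
  using Aut_pow[OF Aut, of n] by (simp add: Aut_iff)

lemma sets_transfer [measurable]:
  assumes [measurable]: "A \<in> sets M" "B \<in> sets M"
  shows "{x \<in> A. (T ^^ n) x \<in> B} \<in> sets M"
proof -
  have "{x \<in> A. (T ^^ n) x \<in> B} = A \<inter> ((T ^^ n) -` B \<inter> space M)"
    using sets.sets_into_space[OF assms(1)] by auto
  then show ?thesis
    by simp
qed

lemma sets_moved [measurable]: "A \<in> sets M \<Longrightarrow> moved (T ^^ n) A \<in> sets M"
proof -
  assume A: "A \<in> sets M"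
  have "moved (T ^^ n) A = A - {x \<in> A. (T ^^ n) x \<in> A}"
    by (auto simp: moved_def)
  then show ?thesis using A by simp
qed

lemma measure_pow_vimage:
  "A \<in> sets M \<Longrightarrow> measure M ((T ^^ n) -` A \<inter> space M) = measure M A"
  using Aut_pow[OF Aut, of n] by (simp add: Aut_iff measure_def)

lemma measure_pow_image_Int:
  assumes "A \<in> sets M" "B \<in> sets M"
  shows "measure M ((T ^^ n) ` A \<inter> B) = measure M {x \<in> A. (T ^^ n) x \<in> B}"
proof -
  have S: "inj_on (T ^^ n) (space M)" "(T ^^ n) ` A \<in> sets M"
    using Aut_pow[OF Aut, of n] assms by (auto simp: Aut_iff bij_betw_def)
  have "(T ^^ n) -` ((T ^^ n) ` A \<inter> B) \<inter> space M = {x \<in> A. (T ^^ n) x \<in> B}"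
    using sets.sets_into_space[OF assms(1)] S(1) by (auto simp: inj_on_def subset_eq)
  then show ?thesis
    using measure_pow_vimage[of "(T ^^ n) ` A \<inter> B" n] S(2) assms by simp
qed

text \<open>A point that ends outside \<open>A\<close> is either already outside after
  \<open>n\<close> steps, or it is in \<open>A\<close> then and the remaining \<open>m\<close> steps
  move it out.\<close>

lemma measure_moved_add:
  assumes A: "A \<in> sets M"
  shows "measure M (moved (T ^^ (m + n)) A) \<le> measure M (moved (T ^^ m) A) + measure M (moved (T ^^ n) A)"
proof -
  have "moved (T ^^ (m + n)) A \<subseteq> ((T ^^ n) -` moved (T ^^ m) A \<inter> space M) \<union> moved (T ^^ n) A"
    using sets.sets_into_space[OF A] by (auto simp: moved_def funpow_add)
  then have "measure M (moved (T ^^ (m + n)) A)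
      \<le> measure M (((T ^^ n) -` moved (T ^^ m) A \<inter> space M) \<union> moved (T ^^ n) A)"
    using A by (intro finite_measure_mono) auto
  also have "\<dots> \<le> measure M ((T ^^ n) -` moved (T ^^ m) A \<inter> space M) + measure M (moved (T ^^ n) A)"
    using A by (intro measure_Un_le) auto
  finally show ?thesis
    using A by (simp add: measure_pow_vimage)
qed

lemma measure_sym_diff_pow:
  assumes A: "A \<in> sets M"
  shows "measure M (sym_diff ((T ^^ n) ` A) A) = 2 * measure M (moved (T ^^ n) A)"
proof -
  let ?TA = "(T ^^ n) ` A"
  have TA: "?TA \<in> sets M"
    using Aut_pow[OF Aut, of n] A by (auto simp: Aut_iff)
  have "measure M ?TA = measure M A"
    using measure_pow_image_Int[OF A sets.top, of n] sets.sets_into_space[OF A]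
      sets.sets_into_space[OF TA] pow_mem
    by (simp add: Int_absorb2 subset_eq Collect_conj_eq2[symmetric] cong: conj_cong)
  moreover have "measure M (?TA - A) = measure M ?TA - measure M (?TA \<inter> A)"
    using A TA by (intro finite_measure_Diff')
  moreover have "measure M (A - ?TA) = measure M A - measure M (?TA \<inter> A)"
    using A TA finite_measure_Diff'[OF A TA] by (simp add: Int_commute)
  moreover have "measure M (moved (T ^^ n) A) = measure M A - measure M {x \<in> A. (T ^^ n) x \<in> A}"
  proof -
    have "moved (T ^^ n) A = A - {x \<in> A. (T ^^ n) x \<in> A}"
      by (auto simp: moved_def)
    then show ?thesis
      using A by (simp add: finite_measure_Diff subset_eq)
  qed
  moreover have "measure M (sym_diff ?TA A) = measure M (?TA - A) + measure M (A - ?TA)"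
    using A TA by (intro finite_measure_Union) auto
  ultimately show ?thesis
    using measure_pow_image_Int[OF A A, of n] by simp
qed

lemma weak_dist_pow_id:
  assumes "range E \<subseteq> sets M"
  shows "weak_dist M E (T ^^ n) id = (\<Sum>k. (1/2) ^ Suc k * (2 * measure M (moved (T ^^ n) (E k))))"
  unfolding weak_dist_def using assms by (simp add: measure_sym_diff_pow image_subset_iff)

text \<open>Reduces a weak neighbourhood to finitely many sets: the first \<open>N\<close> of them
  contribute at most \<epsilon> / 2 and the trivial bound on the others sums to
  \<open>2 * (1/2) ^ N\<close>, which is below \<epsilon> / 2.\<close>

lemma weak_dist_pow_small:
  assumes E: "range E \<subseteq> sets M" and "\<epsilon> > 0"
  obtains N where "\<And>n. (\<And>k. k < N \<Longrightarrow> measure M (moved (T ^^ n) (E k)) \<le> \<epsilon> / 4)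
      \<Longrightarrow> weak_dist M E (T ^^ n) id < \<epsilon>"
proof -
  obtain N where N: "(1/2) ^ N < \<epsilon> / 4"
    using real_arch_pow_inv[of "\<epsilon>/4" "1/2"] \<open>\<epsilon> > 0\<close> by auto
  show ?thesis
  proof (rule that[of N])
    fix n assume small: "\<And>k. k < N \<Longrightarrow> measure M (moved (T ^^ n) (E k)) \<le> \<epsilon> / 4"
    define a where "a k = measure M (moved (T ^^ n) (E k))" for k
    define t where "t k = (if k < N then 0 else (1/2) ^ Suc k :: real)" for k
    have "(\<lambda>k. t (k + N)) = (\<lambda>k. (1/2) ^ N * (1/2) ^ Suc k)"
      by (simp add: t_def fun_eq_iff power_add)
    then have "(\<lambda>k. t (k + N)) sums ((1/2) ^ N)"
      using sums_mult[OF power_half_series, of "(1/2) ^ N"] by simp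
    then have "t sums ((1/2) ^ N + sum t {..<N})"
      by (rule sums_iff_shift[THEN iffD1])
    then have t: "t sums ((1/2) ^ N)"
      by (simp add: t_def)
    have bound: "(\<lambda>k. (1/2) ^ Suc k * (\<epsilon> / 2) + 2 * t k) sums (1 * (\<epsilon> / 2) + 2 * (1/2) ^ N)"
      by (intro sums_add sums_mult sums_mult2 t power_half_series)
    have le: "(1/2) ^ Suc k * (2 * a k) \<le> (1/2) ^ Suc k * (\<epsilon> / 2) + 2 * t k" for k
    proof (cases "k < N")
      case True
      have "(1/2) ^ Suc k * (2 * a k) \<le> (1/2) ^ Suc k * (\<epsilon> / 2)"
        using small[OF True] by (intro mult_left_mono) (auto simp: a_def)
      then show ?thesis by (simp add: t_def True)
    next
      case False
      have "(1/2) ^ Suc k * (2 * a k) \<le> (1/2) ^ Suc k * (2 * 1)"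
        by (intro mult_left_mono) (auto simp: a_def)
      also have "\<dots> \<le> (1/2) ^ Suc k * (\<epsilon> / 2) + 2 * t k"
        using False \<open>\<epsilon> > 0\<close> by (simp add: t_def)
      finally show ?thesis .
    qed
    have "summable (\<lambda>k. (1/2) ^ Suc k * (2 * a k))"
      by (rule summable_comparison_test'[OF sums_summable[OF bound], of 0])
        (use le in \<open>auto simp: a_def\<close>)
    then have "(\<Sum>k. (1/2) ^ Suc k * (2 * a k)) \<le> 1 * (\<epsilon> / 2) + 2 * (1/2) ^ N"
      using le bound by (metis (no_types, lifting) sums_iff suminf_le)
    then show "weak_dist M E (T ^^ n) id < \<epsilon>"
      using N by (simp add: weak_dist_pow_id[OF E] a_def)
  qed
qed

lemma weak_dist_pow_nonneg:
  assumes E: "range E \<subseteq> sets M"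
  shows "weak_dist M E (T ^^ n) id \<ge> 0"
proof -
  have "summable (\<lambda>k. (1/2) ^ Suc k * (2 * measure M (moved (T ^^ n) (E k))))"
    by (rule summable_comparison_test'[OF summable_mult2[OF sums_summable[OF power_half_series], of 2], of 0])
      (auto intro!: mult_left_mono)
  then show ?thesis
    unfolding weak_dist_pow_id[OF E] by (intro suminf_nonneg) auto
qed

text \<open>If near-identity powers can imitate \<open>T\<close> on a set of positive measure, then products of them
  can imitate every power \<open>T ^^ m\<close>, and ergodicity does the rest.\<close>

theorem whirlyI:
  assumes gen: "generating_family M E"
    and ergodic: "\<And>A B. \<lbrakk>A \<in> sets M; B \<in> sets M; measure M A > 0; measure M B > 0\<rbrakk>
      \<Longrightarrow> \<exists>m. measure M {x \<in> A. (T ^^ m) x \<in> B} > 0"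
    and imitate: "\<And>\<F> \<eta> N A B. \<lbrakk>finite \<F>; \<F> \<subseteq> sets M; \<eta> > 0; A \<in> sets M; B \<in> sets M;
        measure M {x \<in> A. T x \<in> B} > 0\<rbrakk>
      \<Longrightarrow> \<exists>n\<ge>N. (\<forall>C\<in>\<F>. measure M (moved (T ^^ n) C) \<le> \<eta>) \<and> measure M {x \<in> A. (T ^^ n) x \<in> B} > 0"
  shows "whirly M E T"
proof -
  have E: "range E \<subseteq> sets M"
    using gen by (auto simp: generating_family_def)
  have imitate_pow: "\<exists>n. (\<forall>C\<in>\<F>. measure M (moved (T ^^ n) C) \<le> \<eta>) \<and> measure M {x \<in> A. (T ^^ n) x \<in> B} > 0"
    if "finite \<F>" "\<F> \<subseteq> sets M" "\<eta> > 0" "A \<in> sets M" "B \<in> sets M"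
      "measure M {x \<in> A. (T ^^ m) x \<in> B} > 0" for \<F> \<eta> A B m
    using that(3-)
  proof (induction m arbitrary: \<eta> B)
    case 0
    then show ?case
      by (intro exI[of _ 0]) (auto simp: moved_def)
  next
    case (Suc m)
    have "{x \<in> A. T x \<in> (T ^^ m) -` B \<inter> space M} = {x \<in> A. (T ^^ Suc m) x \<in> B}"
      using sets.sets_into_space[OF \<open>A \<in> sets M\<close>] pow_mem[of _ 1] by (auto simp: funpow_swap1)
    then have "\<exists>n\<ge>0. (\<forall>C\<in>\<F>. measure M (moved (T ^^ n) C) \<le> \<eta>/2) \<and>
        measure M {x \<in> A. (T ^^ n) x \<in> (T ^^ m) -` B \<inter> space M} > 0"
      using Suc.prems that(1,2) by (intro imitate) auto
    then obtain n where n: "\<And>C. C \<in> \<F> \<Longrightarrow> measure M (moved (T ^^ n) C) \<le> \<eta>/2"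
        "measure M {x \<in> A. (T ^^ n) x \<in> (T ^^ m) -` B \<inter> space M} > 0"
      by blast
    \<comment> \<open>Powers of \<open>T\<close> commute, so the power \<open>n\<close> that
      imitates one step can be absorbed into the target set. What remains is a statement about
      \<open>T ^^ m\<close> with a new target, which is why the induction generalizes
      \<open>B\<close> and \<eta>.\<close>
    have "{x \<in> A. (T ^^ n) x \<in> (T ^^ m) -` B \<inter> space M} = {x \<in> A. (T ^^ m) x \<in> (T ^^ n) -` B \<inter> space M}"
      using sets.sets_into_space[OF \<open>A \<in> sets M\<close>] pow_mem
      by (auto simp: funpow_add[THEN fun_cong, unfolded comp_def, symmetric] add.commute)
    then obtain k where k: "\<And>C. C \<in> \<F> \<Longrightarrow> measure M (moved (T ^^ k) C) \<le> \<eta>/2"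
        "measure M {x \<in> A. (T ^^ k) x \<in> (T ^^ n) -` B \<inter> space M} > 0"
      using Suc.IH[of "\<eta>/2" "(T ^^ n) -` B \<inter> space M"] Suc.prems n(2) by auto
    have "{x \<in> A. (T ^^ k) x \<in> (T ^^ n) -` B \<inter> space M} = {x \<in> A. (T ^^ (n + k)) x \<in> B}"
      using sets.sets_into_space[OF \<open>A \<in> sets M\<close>] pow_mem by (auto simp: funpow_add)
    moreover have "measure M (moved (T ^^ (n + k)) C) \<le> \<eta>" if "C \<in> \<F>" for C
      using measure_moved_add[of C n k] n(1)[OF that] k(1)[OF that] that \<open>\<F> \<subseteq> sets M\<close> by auto
    ultimately show ?case
      using k(2) by metis
  qed
  have "\<exists>n\<ge>N. weak_dist M E (T ^^ n) id < \<epsilon>" if "\<epsilon> > 0" for N \<epsilon>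
  proof -
    obtain K where K: "\<And>n. (\<And>k. k < K \<Longrightarrow> measure M (moved (T ^^ n) (E k)) \<le> \<epsilon> / 4)
        \<Longrightarrow> weak_dist M E (T ^^ n) id < \<epsilon>"
      using weak_dist_pow_small[OF E \<open>\<epsilon> > 0\<close>] by blast
    \<comment> \<open>With the whole space as source and target, imitation just supplies arbitrarily
      late powers near the identity, which is rigidity.\<close>
    have "{x \<in> space M. T x \<in> space M} = space M"
      using pow_mem[of _ 1] by auto
    moreover have "E ` {..<K} \<subseteq> sets M"
      using E by blast
    ultimately obtain n where "n \<ge> N" "\<And>k. k < K \<Longrightarrow> measure M (moved (T ^^ n) (E k)) \<le> \<epsilon> / 4"
      using imitate[of "E ` {..<K}" "\<epsilon>/4" "space M" "space M" N] \<open>\<epsilon> > 0\<close> by (auto simp: prob_space)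
    then show ?thesis
      using K by blast
  qed
  then have "\<forall>N. \<exists>n\<ge>N. weak_dist M E (T ^^ n) id < inverse (Suc N)"
    by simp
  then obtain f where f: "\<And>N. f N \<ge> N" "\<And>N. weak_dist M E (T ^^ f N) id < inverse (Suc N)"
    by metis
  have "rigid M E T"
    unfolding rigid_def
  proof (intro conjI exI[of _ "\<lambda>N. int (f N)"])
    have "filterlim f at_top sequentially"
      using f(1) by (rule filterlim_at_top_mono[OF filterlim_ident, OF always_eventually, rule_format])
    then show "filterlim (\<lambda>N. int (f N)) at_top sequentially"
      by (rule filterlim_compose[OF filterlim_int_sequentially])
    show "(\<lambda>k. weak_dist M E (int_iter M T (int (f k))) id) \<longlonglongrightarrow> 0"
    proof (rule tendsto_sandwich[OF _ _ tendsto_const LIMSEQ_inverse_real_of_nat])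
      show "\<forall>\<^sub>F n in sequentially. 0 \<le> weak_dist M E (int_iter M T (int (f n))) id"
        using weak_dist_pow_nonneg[OF E] by simp
      show "\<forall>\<^sub>F n in sequentially. weak_dist M E (int_iter M T (int (f n))) id \<le> inverse (real (Suc n))"
        using f(2) by (intro always_eventually allI) (simp add: less_imp_le)
    qed
  qed (use Aut prob_space_axioms in auto)
  moreover have "\<exists>n. int_iter M T n \<in> weak_nbhd M E \<epsilon> \<and> measure M (int_iter M T n ` A \<inter> B) > 0"
    if H: "\<epsilon> > 0" "A \<in> sets M" "B \<in> sets M" "measure M A > 0" "measure M B > 0" for \<epsilon> A B
  proof -
    obtain K where K: "\<And>n. (\<And>k. k < K \<Longrightarrow> measure M (moved (T ^^ n) (E k)) \<le> \<epsilon> / 4)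
        \<Longrightarrow> weak_dist M E (T ^^ n) id < \<epsilon>"
      using weak_dist_pow_small[OF E \<open>\<epsilon> > 0\<close>] by blast
    obtain m where "measure M {x \<in> A. (T ^^ m) x \<in> B} > 0"
      using ergodic[OF H(2-5)] by blast
    moreover have "E ` {..<K} \<subseteq> sets M"
      using E by blast
    ultimately obtain n where n: "\<And>k. k < K \<Longrightarrow> measure M (moved (T ^^ n) (E k)) \<le> \<epsilon> / 4"
        "measure M {x \<in> A. (T ^^ n) x \<in> B} > 0"
      using imitate_pow[of "E ` {..<K}" "\<epsilon>/4" A B m] H(1-3) by auto
    have "int_iter M T (int n) \<in> weak_nbhd M E \<epsilon>"
      using K[OF n(1)] Aut_pow[OF Aut, of n] by (simp add: weak_nbhd_def)
    moreover have "measure M (int_iter M T (int n) ` A \<inter> B) > 0"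
      using n(2) H(2,3) by (simp add: measure_pow_image_Int)
    ultimately show ?thesis
      by blast
  qed
  ultimately show ?thesis
    unfolding whirly_def by blast
qed

end

section \<open>The exchange as an induced rotation\<close>

locale iet3 =
  fixes l1 l2 l3 :: real
  assumes pos: "l1 > 0" "l2 > 0" "l3 > 0"
begin

definition s where "s = l1 + l2 + l3"
text \<open>Twice \<open>l2\<close>, because points of the middle interval pass through an added arc
  \<open>[s, L)\<close> of length \<open>l2\<close> before they return.\<close>

definition L where "L = l1 + 2 * l2 + l3"
definition \<alpha> where "\<alpha> = l2 + l3"

definition T :: "real \<Rightarrow> real" where
  "T x = (if x < l1 then x + l2 + l3 else if x < l1 + l2 then x + l3 - l1 else x - l1 - l2)"

definition R :: "real \<Rightarrow> real" where
  "R x = (if x + \<alpha> < L then x + \<alpha> else x + \<alpha> - L)"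

definition visits :: "nat \<Rightarrow> real \<Rightarrow> nat" where
  "visits n x = (\<Sum>i<n. of_bool (s \<le> (R ^^ i) x))"

text \<open>The first point in \<open>[0, s)\<close> on the rotation orbit of \<open>y\<close>: by
  \<open>R_less_s\<close> the added arc is left after a single step.\<close>

definition return_pt :: "real \<Rightarrow> real" where
  "return_pt y = (if y < s then y else R y)"

lemma s_pos: "s > 0" and L_pos: "L > 0" and s_less_L: "s < L" and L_eq: "L = s + l2"
  and \<alpha>_pos: "\<alpha> > 0" and \<alpha>_less_s: "\<alpha> < s"
  using pos by (auto simp: s_def L_def \<alpha>_def)

lemma T_mem: "x \<in> {0..<s} \<Longrightarrow> T x \<in> {0..<s}"
  using pos by (auto simp: T_def s_def)

lemma T_pow_mem: "x \<in> {0..<s} \<Longrightarrow> (T ^^ n) x \<in> {0..<s}"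
  by (induction n) (use T_mem in auto)

lemma T_eq_return_pt: "y \<in> {0..<s} \<Longrightarrow> T y = return_pt (R y)"
  using pos by (auto simp: return_pt_def R_def T_def s_def L_def \<alpha>_def)

lemma R_less_s: "y \<in> {s..<L} \<Longrightarrow> R y < s"
  using pos by (auto simp: R_def s_def L_def \<alpha>_def)

lemma R_pow:
  assumes "x \<in> {0..<L}"
  shows "(R ^^ n) x = L * frac ((x + n * \<alpha>) / L)"
proof (induction n)
  case 0
  have "frac (x / L) = x / L"
    using assms L_pos by (subst frac_eq) auto
  then show ?case using L_pos by simp
next
  case (Suc n)
  define v where "v = (x + n * \<alpha>) / L"
  have v: "(x + real (Suc n) * \<alpha>) / L = v + \<alpha> / L"
    by (simp add: v_def add_divide_distrib algebra_simps)
  have fa: "frac (\<alpha> / L) = \<alpha> / L"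
    using \<alpha>_pos \<alpha>_less_s s_less_L by (subst frac_eq) auto
  have lt: "L * frac v + \<alpha> < L \<longleftrightarrow> frac v + \<alpha> / L < 1"
    using L_pos by (simp add: field_simps)
  have "(R ^^ Suc n) x = R (L * frac v)"
    using Suc by (simp add: v_def)
  also have "\<dots> = L * frac (v + \<alpha> / L)"
    unfolding R_def lt frac_add fa using L_pos by (simp add: distrib_left right_diff_distrib)
  finally show ?case by (simp only: v)
qed

lemma R_pow_mem: "x \<in> {0..<L} \<Longrightarrow> (R ^^ n) x \<in> {0..<L}"
  using L_pos by (simp add: R_pow frac_lt_1)

text \<open>Each visit to \<open>[s, L)\<close> costs one rotation step that is not a step of
  \<open>T\<close>. A visit at time \<open>n\<close> itself is not yet counted, so the step of
  \<open>T\<close> in progress is completed by \<open>return_pt\<close>.\<close>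

lemma T_pow_visits:
  assumes x: "x \<in> {0..<s}"
  shows "visits n x \<le> n \<and> (T ^^ (n - visits n x)) x = return_pt ((R ^^ n) x)"
proof (induction n)
  case 0
  then show ?case using x by (simp add: visits_def return_pt_def)
next
  case (Suc n)
  have mem: "(R ^^ n) x \<in> {0..<L}"
    using x s_less_L by (intro R_pow_mem) auto
  show ?case
  proof (cases "(R ^^ n) x < s")
    case True
    then have "visits (Suc n) x = visits n x"
      by (simp add: visits_def)
    moreover have "T ((R ^^ n) x) = return_pt (R ((R ^^ n) x))"
      using True mem by (intro T_eq_return_pt) auto
    ultimately show ?thesis
      using Suc True by (simp add: Suc_diff_le return_pt_def)
  next
    case False
    then have "visits (Suc n) x = Suc (visits n x)"
      by (simp add: visits_def)
    moreover have "R ((R ^^ n) x) < s"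
      using False mem by (intro R_less_s) auto
    ultimately show ?thesis
      using Suc False by (simp add: return_pt_def)
  qed
qed

lemma T_pow_eq_translate:
  fixes x :: real and n :: nat and k :: int
  assumes x: "x \<in> {0..<s}" and y: "x + n * \<alpha> - k * L \<in> {0..<s}"
  shows "(T ^^ (n - visits n x)) x = x + n * \<alpha> - k * L"
proof -
  define z where "z = x + n * \<alpha> - k * L"
  have "(x + n * \<alpha>) / L = z / L + of_int k"
    using L_pos by (simp add: z_def field_simps)
  moreover have "frac (z / L) = z / L"
    using y s_less_L by (subst frac_eq) (auto simp: z_def)
  ultimately have "frac ((x + n * \<alpha>) / L) = z / L"
    by (simp add: frac_def)
  then have "(R ^^ n) x = z"
    using x s_less_L L_pos by (simp add: R_pow)
  then show ?thesis
    using T_pow_visits[OF x, of n] y by (simp add: return_pt_def z_def)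
qed

text \<open>The point \<open>L * frac v\<close> lies in \<open>[s, L)\<close> exactly when adding
  \<open>l2 / L\<close> to \<open>v\<close> crosses an integer, and then the floor rises by
  1.\<close>

lemma visits_eq_sum_floor:
  fixes x :: real and n :: nat
  assumes x: "x \<in> {0..<s}"
  shows "int (visits n x)
    = (\<Sum>i<n. \<lfloor>(x + l2) / L + i * (\<alpha> / L)\<rfloor>) - (\<Sum>i<n. \<lfloor>x / L + i * (\<alpha> / L)\<rfloor>)"
proof -
  have "int (of_bool (s \<le> (R ^^ i) x)) = \<lfloor>(x + l2) / L + i * (\<alpha> / L)\<rfloor> - \<lfloor>x / L + i * (\<alpha> / L)\<rfloor>" for i
  proof -
    define v where "v = (x + i * \<alpha>) / L"
    have v: "x / L + i * (\<alpha> / L) = v" "(x + l2) / L + i * (\<alpha> / L) = v + l2 / L"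
      by (simp_all add: v_def add_divide_distrib)
    have "s \<le> L * frac v \<longleftrightarrow> \<not> frac v + l2 / L < 1"
    proof -
      have "s \<le> L * frac v \<longleftrightarrow> L \<le> L * (frac v + l2 / L)"
        using L_pos by (simp add: L_eq distrib_left)
      then show ?thesis
        using L_pos by (simp add: not_less)
    qed
    moreover have "frac (l2 / L) = l2 / L" "\<lfloor>l2 / L\<rfloor> = 0"
      using pos s_pos L_eq by (auto simp: frac_eq floor_eq_iff)
    moreover have "\<lfloor>v + l2 / L\<rfloor> = (if frac v + l2 / L < 1 then \<lfloor>v\<rfloor> else \<lfloor>v\<rfloor> + 1)"
      using calculation floor_add[of v "l2 / L"] by simp
    ultimately show ?thesis
      using x s_less_L unfolding v by (simp add: R_pow v_def)
  qed
  then show ?thesis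
    unfolding visits_def of_nat_sum sum_subtractf[symmetric] by (intro sum.cong refl)
qed

text \<open>The times \<open>n = q - \<lfloor>q * l2 / L\<rfloor>\<close> for which \<open>T ^^ n\<close> is compared with the translation by
  \<open>q * \<alpha> - p * L\<close>: on one part of the space it agrees with it, on another part it is one step ahead.\<close>

context
  fixes p :: int and q :: nat and \<delta> c :: real
  assumes q: "q > 0" "coprime p (int q)"
    and \<alpha>: "\<bar>\<alpha> / L - p / q\<bar> \<le> \<delta> / q\<^sup>2"
    and c: "frac (q * l2 / L) = c"
    and \<delta>: "0 \<le> \<delta>"
begin

lemma visits_eq_floor_diff:
  fixes x :: real
  assumes x: "x \<in> {0..<s}"
    and "\<delta> \<le> frac (q * x / L)" "frac (q * x / L) < 1 - \<delta>"
    and "\<delta> \<le> frac (q * (x + l2) / L)" "frac (q * (x + l2) / L) < 1 - \<delta>"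
  shows "int (visits q x) = \<lfloor>q * (x + l2) / L\<rfloor> - \<lfloor>q * x / L\<rfloor>"
  using visits_eq_sum_floor[OF x, of q] sum_floor_rotation[OF q \<alpha>, of "x / L"]
    sum_floor_rotation[OF q \<alpha>, of "(x + l2) / L"] assms by simp

text \<open>The two floors in \<open>visits_eq_floor_diff\<close> have arguments differing by
  \<open>q * l2 / L\<close>, with fractional part \<open>c\<close>. Here adding \<open>c\<close>
  produces no carry; in \<open>visits_high\<close> it produces one, which is the extra
  visit.\<close>

lemma visits_low:
  fixes x :: real
  assumes x: "x \<in> {0..<s}" and "\<delta> \<le> frac (q * x / L)" "frac (q * x / L) < 1 - c - \<delta>"
  shows "int (visits q x) = \<lfloor>q * l2 / L\<rfloor>"
proof -
  have *: "q * (x + l2) / L = q * x / L + q * l2 / L"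
    by (simp add: add_divide_distrib distrib_left)
  have "c \<ge> 0" using c by auto
  have "frac (q * (x + l2) / L) = frac (q * x / L) + c"
    unfolding * frac_add using assms c \<delta> by auto
  moreover have "\<lfloor>q * (x + l2) / L\<rfloor> = \<lfloor>q * x / L\<rfloor> + \<lfloor>q * l2 / L\<rfloor>"
    unfolding * floor_add using assms c \<delta> by auto
  ultimately show ?thesis
    using visits_eq_floor_diff[OF x] assms \<open>c \<ge> 0\<close> by simp
qed

lemma visits_high:
  fixes x :: real
  assumes x: "x \<in> {0..<s}" and "1 - c + \<delta> \<le> frac (q * x / L)" "frac (q * x / L) < 1 - \<delta>"
  shows "int (visits q x) = \<lfloor>q * l2 / L\<rfloor> + 1"
proof -
  have *: "q * (x + l2) / L = q * x / L + q * l2 / L"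
    by (simp add: add_divide_distrib distrib_left)
  have c1: "c < 1" using c frac_lt_1 by blast
  have "frac (q * (x + l2) / L) = frac (q * x / L) + c - 1"
    unfolding * frac_add using assms c \<delta> by auto
  moreover have "\<lfloor>q * (x + l2) / L\<rfloor> = \<lfloor>q * x / L\<rfloor> + \<lfloor>q * l2 / L\<rfloor> + 1"
    unfolding * floor_add using assms c \<delta> by auto
  ultimately show ?thesis
    using visits_eq_floor_diff[OF x] assms c1 by simp
qed

lemma T_pow_low:
  fixes x :: real
  assumes x: "x \<in> {0..<s}" "x + (q * \<alpha> - p * L) \<in> {0..<s}"
    and "\<delta> \<le> frac (q * x / L)" "frac (q * x / L) < 1 - c - \<delta>"
  shows "(T ^^ (q - nat \<lfloor>q * l2 / L\<rfloor>)) x = x + (q * \<alpha> - p * L)"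
proof -
  have "visits q x = nat \<lfloor>q * l2 / L\<rfloor>"
    using visits_low[OF x(1) assms(3,4)] by linarith
  then show ?thesis
    using T_pow_eq_translate[of x q p] x by (simp add: add_diff_eq)
qed

text \<open>With one visit more, the orbit has spent one step of \<open>T\<close> fewer in
  \<open>q\<close> rotation steps, so the common exponent leaves a further application of
  \<open>T\<close>.\<close>

lemma T_pow_high:
  fixes x :: real
  assumes x: "x \<in> {0..<s}" "x + (q * \<alpha> - p * L) \<in> {0..<s}"
    and "1 - c + \<delta> \<le> frac (q * x / L)" "frac (q * x / L) < 1 - \<delta>"
  shows "(T ^^ (q - nat \<lfloor>q * l2 / L\<rfloor>)) x = T (x + (q * \<alpha> - p * L))"
proof -
  have v: "visits q x = Suc (nat \<lfloor>q * l2 / L\<rfloor>)"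
  proof -
    have "\<lfloor>q * l2 / L\<rfloor> \<ge> 0"
      using pos L_pos by simp
    then show ?thesis
      using visits_high[OF x(1) assms(3,4)] by linarith
  qed
  \<comment> \<open>The bound of the visits by \<open>q\<close> is what keeps the subtraction of
    natural numbers exact here.\<close>
  then have "q - nat \<lfloor>q * l2 / L\<rfloor> = Suc (q - visits q x)"
    using T_pow_visits[OF x(1), of q] by linarith
  then show ?thesis
    using T_pow_eq_translate[of x q p] x by (simp add: add_diff_eq)
qed

lemma translation_small: "\<bar>q * \<alpha> - p * L\<bar> \<le> L * \<delta> / q"
proof -
  have "\<bar>q * \<alpha> - p * L\<bar> = q * L * \<bar>\<alpha> / L - p / q\<bar>"
    using q L_pos by (subst abs_of_pos[of "q * L", symmetric]) (auto simp: abs_mult[symmetric] field_simps)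
  also have "\<dots> \<le> q * L * (\<delta> / q\<^sup>2)"
    using \<alpha> L_pos by (intro mult_left_mono) auto
  finally show ?thesis
    using q by (simp add: power2_eq_square)
qed

end

end

section \<open>Near-identity powers of the exchange\<close>

text \<open>On the circle the \<open>r\<close> shifts are spaced by \<open>1 / r\<close>, so they
  meet every half-open window at least that long; \<open>u + e \<le> 1\<close> prevents the window
  from wrapping around.\<close>

lemma exists_shift_frac_mem:
  fixes u e v :: real and r :: nat
  assumes "r > 0" "0 \<le> u" "1 / r \<le> e" "u + e \<le> 1"
  shows "\<exists>j<r. u \<le> frac (v - j / r) \<and> frac (v - j / r) < u + e"
proof -
  define f where "f = frac (v - u)"
  define j where "j = nat \<lfloor>r * f\<rfloor>"
  have f: "0 \<le> f" "f < 1"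
    by (auto simp: f_def frac_lt_1)
  have "r * f < r" "0 \<le> r * f"
    using f \<open>r > 0\<close> by auto
  then have j: "real j \<le> r * f" "r * f < j + 1" "j < r"
    by (auto simp: j_def nat_less_iff floor_less_iff) linarith
  have "f - j / r = (r * f - j) / r"
    using \<open>r > 0\<close> by (simp add: field_simps)
  then have fj: "0 \<le> f - j / r" "f - j / r < 1 / r"
    using \<open>r > 0\<close> j(1,2) by (auto intro: divide_strict_right_mono)
  have "frac (v - j / r) = u + (f - j / r)"
    using fj assms by (subst frac_unique_iff) (auto simp: f_def frac_def)
  then show ?thesis
    using fj j(3) assms by (intro exI[of _ j]) auto
qed

text \<open>This replaces the equidistribution of periodic sets of small period.\<close>

lemma measure_Int_ge_of_cover:
  fixes C G :: "real set" and r :: nat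
  assumes [measurable]: "C \<in> sets borel" "G \<in> sets borel" and "bounded C"
    and cover: "\<And>x. \<exists>j<r. x - j * h \<in> G"
    and inv: "\<And>j. j < r \<Longrightarrow> measure lborel {x \<in> C. x - j * h \<notin> C} \<le> m"
  shows "measure lborel C \<le> r * (m + measure lborel (C \<inter> G))"
proof -
  define P where "P j = {x \<in> C. x - real j * h \<notin> C}" for j
  define Q where "Q j = {x. x + (- (real j * h)) \<in> C \<inter> G}" for j
  have [measurable]: "P j \<in> sets borel" "Q j \<in> sets borel" for j
    unfolding P_def Q_def by measurable
  have fin: "emeasure lborel D < \<infinity>" if "D \<subseteq> C" for D
    using bounded_subset[OF \<open>bounded C\<close> that] emeasure_bounded_finite by blast
  have Q: "emeasure lborel (Q j) = emeasure lborel (C \<inter> G)" for j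
    unfolding Q_def by (rule emeasure_lborel_translate_vimage) measurable
  have "P j \<in> fmeasurable lborel" for j
    using fin[of "P j"] by (intro fmeasurableI) (simp_all add: P_def)
  moreover have "Q j \<in> fmeasurable lborel" for j
    using fin[of "C \<inter> G"] Q[of j] by (intro fmeasurableI) simp_all
  ultimately have PQ: "P j \<union> Q j \<in> fmeasurable lborel" for j
    by (intro fmeasurable.Un)
  \<comment> \<open>For \<open>x\<close> in \<open>C\<close> take a shift that reaches
    \<open>G\<close>: either it leaves \<open>C\<close>, or it lands in \<open>C \<inter> G\<close>,
    and then \<open>x\<close> lies in the translate \<open>Q j\<close> of that set.\<close>
  have "C \<subseteq> (\<Union>j<r. P j \<union> Q j)"
  proof
    fix x assume "x \<in> C"
    moreover obtain j where "j < r" "x - j * h \<in> G"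
      using cover by blast
    ultimately show "x \<in> (\<Union>j<r. P j \<union> Q j)"
      by (auto simp: P_def Q_def)
  qed
  then have "measure lborel C \<le> measure lborel (\<Union>j<r. P j \<union> Q j)"
    using PQ by (intro measure_mono_fmeasurable) (auto intro!: fmeasurable.finite_UN)
  also have "\<dots> \<le> (\<Sum>j<r. measure lborel (P j \<union> Q j))"
    by (intro measure_UNION_le) auto
  also have "\<dots> \<le> (\<Sum>j<r. m + measure lborel (C \<inter> G))"
  proof (intro sum_mono)
    fix j assume "j \<in> {..<r}"
    have "measure lborel (P j \<union> Q j) \<le> measure lborel (P j) + measure lborel (Q j)"
      by (intro measure_Un_le) auto
    also have "\<dots> \<le> m + measure lborel (C \<inter> G)"
      using inv[of j] \<open>j \<in> {..<r}\<close> Q[of j] by (simp add: P_def measure_def)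
    finally show "measure lborel (P j \<union> Q j) \<le> m + measure lborel (C \<inter> G)" .
  qed
  finally show ?thesis by simp
qed

lemma fmeasurable_bounded_borel:
  fixes A :: "'a::euclidean_space set"
  assumes "A \<in> sets borel" "bounded A"
  shows "A \<in> fmeasurable lborel"
  using assms emeasure_bounded_finite[of A] by (intro fmeasurableI) auto

section \<open>Normalized Lebesgue measure, ergodicity and imitation for the exchange\<close>

context iet3
begin

definition iet_measure :: "real measure" where
  "iet_measure = uniform_measure (restrict_space lborel {0..<s}) {0..<s}"

lemma space_iet_measure [simp]: "space iet_measure = {0..<s}"
  by (simp add: iet_measure_def space_restrict_space)

lemma sets_iet_measure: "A \<in> sets iet_measure \<longleftrightarrow> A \<in> sets borel \<and> A \<subseteq> {0..<s}"
  by (auto simp: iet_measure_def sets_restrict_space_iff)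

lemma emeasure_iet_measure:
  "A \<in> sets iet_measure \<Longrightarrow> emeasure iet_measure A = emeasure lborel A / ennreal s"
  using s_pos unfolding iet_measure_def
  by (subst emeasure_uniform_measure)
    (auto simp: emeasure_restrict_space sets_restrict_space_iff Int_absorb1 subset_eq)

lemma fmeasurable_subset_space:
  assumes "A \<in> sets borel" "A \<subseteq> {0..<s}"
  shows "A \<in> fmeasurable lborel"
proof (rule fmeasurable_bounded_borel[OF assms(1)])
  show "bounded A"
    by (rule bounded_subset[OF bounded_closed_interval[of 0 s]]) (use assms in auto)
qed

lemma measure_iet_measure:
  assumes A: "A \<in> sets iet_measure"
  shows "measure iet_measure A = measure lborel A / s"
proof -
  have "emeasure lborel A = ennreal (measure lborel A)"
    using A by (intro emeasure_eq_measure2 fmeasurable_subset_space) (auto simp: sets_iet_measure)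
  then show ?thesis
    using emeasure_iet_measure[OF A] s_pos by (simp add: measure_def[of iet_measure] divide_ennreal)
qed

lemma prob_space_iet_measure: "prob_space iet_measure"
  unfolding iet_measure_def using s_pos
  by (intro prob_space_uniform_measure) (auto simp: emeasure_restrict_space)

definition T_inv :: "real \<Rightarrow> real" where
  "T_inv y = (if y < l3 then y + l1 + l2 else if y < l2 + l3 then y - l3 + l1 else y - l2 - l3)"

lemma T_inv_T: "x \<in> {0..<s} \<Longrightarrow> T_inv (T x) = x"
  and T_T_inv: "y \<in> {0..<s} \<Longrightarrow> T (T_inv y) = y"
  and T_inv_mem: "y \<in> {0..<s} \<Longrightarrow> T_inv y \<in> {0..<s}"
  using pos by (auto simp: T_def T_inv_def s_def)

lemma measurable_T [measurable]: "T \<in> borel_measurable borel"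
  and measurable_T_inv [measurable]: "T_inv \<in> borel_measurable borel"
  unfolding T_def[abs_def] T_inv_def[abs_def] by measurable

lemma emeasure_vimage_T:
  assumes A: "A \<in> sets borel" "A \<subseteq> {0..<s}"
  shows "emeasure lborel {x \<in> {0..<s}. T x \<in> A} = emeasure lborel A"
proof -
  let ?A1 = "A \<inter> {l2 + l3..<s}" and ?A2 = "A \<inter> {l3..<l2 + l3}" and ?A3 = "A \<inter> {0..<l3}"
  let ?P1 = "{x. x + (l2 + l3) \<in> ?A1}" and ?P2 = "{x. x + (l3 - l1) \<in> ?A2}"
    and ?P3 = "{x. x + (- l1 - l2) \<in> ?A3}"
  note [measurable] = A(1)
  have add3: "emeasure lborel (X \<union> (Y \<union> Z)) = emeasure lborel X + (emeasure lborel Y + emeasure lborel Z)"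
    if "X \<in> sets borel" "Y \<in> sets borel" "Z \<in> sets borel" "X \<inter> (Y \<union> Z) = {}" "Y \<inter> Z = {}"
    for X Y Z :: "real set"
    using that by (simp add: plus_emeasure)
  have "{x \<in> {0..<s}. T x \<in> A} = ?P1 \<union> (?P2 \<union> ?P3)"
    using pos A(2) by (auto simp: T_def s_def algebra_simps)
  moreover have "emeasure lborel (?P1 \<union> (?P2 \<union> ?P3)) = emeasure lborel ?P1 + (emeasure lborel ?P2 + emeasure lborel ?P3)"
  proof (rule add3)
    show "?P1 \<in> sets borel" "?P2 \<in> sets borel" "?P3 \<in> sets borel"
      by measurable
    show "?P1 \<inter> (?P2 \<union> ?P3) = {}" "?P2 \<inter> ?P3 = {}"
      using pos by (auto simp: s_def)
  qed
  moreover have "\<dots> = emeasure lborel ?A1 + (emeasure lborel ?A2 + emeasure lborel ?A3)"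
    by (intro arg_cong2[where f="(+)"] emeasure_lborel_translate_vimage) measurable
  moreover have "\<dots> = emeasure lborel (?A1 \<union> (?A2 \<union> ?A3))"
    using pos by (intro add3[symmetric]) auto
  moreover have "?A1 \<union> (?A2 \<union> ?A3) = A"
    using A(2) by auto
  ultimately show ?thesis
    by simp
qed

lemma T_in_Aut: "T \<in> Aut iet_measure"
  unfolding Aut_iff
proof (intro conjI ballI)
  show bij: "bij_betw T (space iet_measure) (space iet_measure)"
    by (rule bij_betw_byWitness[where f'=T_inv])
      (use T_inv_T T_T_inv T_inv_mem T_mem in \<open>auto simp del: atLeastLessThan_iff\<close>)
  have vimage: "T -` A \<inter> space iet_measure = {x \<in> {0..<s}. T x \<in> A}" for A
    by auto
  have sets_vimage: "T -` A \<inter> space iet_measure \<in> sets iet_measure" if "A \<in> sets iet_measure" for A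
    using that unfolding vimage sets_iet_measure by auto
  then show "T \<in> measurable iet_measure iet_measure"
    using T_mem by (intro measurableI) (auto simp del: atLeastLessThan_iff)
  fix A assume A: "A \<in> sets iet_measure"
  have "T ` A = {y \<in> {0..<s}. T_inv y \<in> A}"
  proof
    show "T ` A \<subseteq> {y \<in> {0..<s}. T_inv y \<in> A}"
      using A T_mem T_inv_T unfolding sets_iet_measure by force
    show "{y \<in> {0..<s}. T_inv y \<in> A} \<subseteq> T ` A"
      using T_T_inv by (metis (no_types, lifting) image_eqI mem_Collect_eq subsetI)
  qed
  then show "T ` A \<in> sets iet_measure"
    using A unfolding sets_iet_measure by auto
  have "emeasure iet_measure (T -` A \<inter> space iet_measure) = emeasure lborel {x \<in> {0..<s}. T x \<in> A} / ennreal s"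
    using emeasure_iet_measure[OF sets_vimage[OF A]] by (simp only: vimage)
  also have "\<dots> = emeasure iet_measure A"
    using A emeasure_vimage_T[of A] by (simp only: emeasure_iet_measure sets_iet_measure)
  finally show "emeasure iet_measure (T -` A \<inter> space iet_measure) = emeasure iet_measure A" .
qed

sublocale iet: automorphism iet_measure T
  using prob_space_iet_measure T_in_Aut by (simp add: automorphism_def automorphism_axioms_def)

text \<open>Some translation by \<open>t0\<close> carries a set \<open>C\<close> of positive measure
  from \<open>A\<close> into \<open>B\<close>. Irrationality gives a multiple of \<alpha> so close
  to \<open>t0\<close> modulo \<open>L\<close> that the part of \<open>C\<close> then missing
  \<open>B\<close> has smaller measure than \<open>C\<close>.\<close>

lemma ergodic:
  assumes irr: "\<alpha> / L \<notin> \<rat>" and AB: "A \<in> sets iet_measure" "B \<in> sets iet_measure"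
    and posA: "measure iet_measure A > 0" and posB: "measure iet_measure B > 0"
  shows "\<exists>m. measure iet_measure {x \<in> A. (T ^^ m) x \<in> B} > 0"
proof -
  have [measurable]: "A \<in> sets borel" "B \<in> sets borel" and sub: "A \<subseteq> {0..<s}" "B \<subseteq> {0..<s}"
    using AB by (auto simp: sets_iet_measure)
  have "measure lborel A > 0" "measure lborel B > 0"
    using posA posB AB s_pos by (auto simp: measure_iet_measure zero_less_divide_iff)
  then have "emeasure lborel A > 0" "emeasure lborel B > 0"
    by (auto simp: measure_def intro: gr_zeroI)
  then obtain t0 where t0: "emeasure lborel {x \<in> A. x + t0 \<in> B} > 0"
    using positive_translate_overlap[of A B] by auto
  define C where "C = {x \<in> A. x + t0 \<in> B}"
  have C [measurable]: "C \<in> sets borel"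
    unfolding C_def by measurable
  have Cf: "C \<in> fmeasurable lborel"
    using sub by (intro fmeasurable_subset_space C) (auto simp: C_def)
  have Cpos: "measure lborel C > 0"
    using t0 emeasure_eq_measure2[OF Cf] by (auto simp: C_def[symmetric])
  have "bounded B"
    by (rule bounded_subset[OF bounded_closed_interval[of 0 s]]) (use sub in auto)
  obtain d where d: "d > 0" "\<And>t. \<bar>t\<bar> < d \<Longrightarrow> measure lborel {x \<in> B. x + t \<notin> B} < measure lborel C"
    using measure_translate_diff_small[OF \<open>B \<in> sets borel\<close> \<open>bounded B\<close> Cpos] by blast
  obtain h k :: int where k: "k > 0" "\<bar>k * (\<alpha> / L) - h - t0 / L\<bar> < d / L"
    by (rule sequence_of_fractional_parts_is_dense[OF irr, of "d / L" "t0 / L"]) (use d L_pos in auto)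
  define n where "n = nat k"
  define t where "t = n * \<alpha> - h * L - t0"
  have "t = L * (k * (\<alpha> / L) - h - t0 / L)"
    using k L_pos by (simp add: t_def n_def field_simps)
  then have "\<bar>t\<bar> = L * \<bar>k * (\<alpha> / L) - h - t0 / L\<bar>"
    using L_pos by (simp only: abs_mult abs_of_pos)
  also have "\<dots> < L * (d / L)"
    using k(2) L_pos by (intro mult_strict_left_mono)
  finally have "\<bar>t\<bar> < d"
    using L_pos by simp
  define D where "D = {x \<in> A. x + (t0 + t) \<in> B}"
  define V where "V = {x. x + t0 \<in> {y \<in> B. y + t \<notin> B}}"
  have [measurable]: "D \<in> sets borel" "V \<in> sets borel"
    unfolding D_def V_def by measurable
  have emV: "emeasure lborel V = emeasure lborel {y \<in> B. y + t \<notin> B}"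
    unfolding V_def by (rule emeasure_lborel_translate_vimage) measurable
  have Bf: "{y \<in> B. y + t \<notin> B} \<in> fmeasurable lborel"
    using sub by (intro fmeasurable_subset_space) auto
  then have Vf: "V \<in> fmeasurable lborel"
    using emV by (intro fmeasurableI) (auto simp: fmeasurable_def)
  have Df: "D \<in> fmeasurable lborel"
    using sub by (intro fmeasurable_subset_space) (auto simp: D_def)
  have "C \<subseteq> D \<union> V"
    by (auto simp: C_def D_def V_def add.assoc)
  then have "measure lborel C \<le> measure lborel (D \<union> V)"
    using Cf Df Vf by (intro measure_mono_fmeasurable) auto
  also have "\<dots> \<le> measure lborel D + measure lborel V"
    by (intro measure_Un_le) auto
  also have "measure lborel V < measure lborel C"
    using emV d(2)[OF \<open>\<bar>t\<bar> < d\<close>] by (simp add: measure_def)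
  finally have "measure lborel D > 0"
    by simp
  have DM: "D \<in> sets iet_measure"
    using sub by (auto simp: sets_iet_measure D_def)
  \<comment> \<open>The exponent that realizes the translation depends on the point, but it takes
    only finitely many values, so one of them serves a set of positive measure.\<close>
  have "D \<subseteq> (\<Union>m\<le>n. {x \<in> A. (T ^^ m) x \<in> B})"
  proof
    fix x assume x: "x \<in> D"
    have eq: "x + n * \<alpha> - h * L = x + (t0 + t)"
      by (simp add: t_def)
    have "(T ^^ (n - visits n x)) x = x + n * \<alpha> - h * L"
      by (rule T_pow_eq_translate) (use x sub in \<open>auto simp only: eq D_def\<close>)
    then show "x \<in> (\<Union>m\<le>n. {x \<in> A. (T ^^ m) x \<in> B})"
      using x unfolding eq D_def by (intro UN_I[of "n - visits n x"]) auto
  qed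
  then have "measure iet_measure D \<le> measure iet_measure (\<Union>m\<le>n. {x \<in> A. (T ^^ m) x \<in> B})"
    using AB by (intro iet.finite_measure_mono) auto
  also have "\<dots> \<le> (\<Sum>m\<le>n. measure iet_measure {x \<in> A. (T ^^ m) x \<in> B})"
    using AB by (intro measure_UNION_le) auto
  finally have "(\<Sum>m\<le>n. measure iet_measure {x \<in> A. (T ^^ m) x \<in> B}) > 0"
    using \<open>measure lborel D > 0\<close> s_pos measure_iet_measure[OF DM] by (smt (verit) divide_pos_pos)
  then show ?thesis
    by (metis (no_types, lifting) sum_nonpos not_less)
qed

text \<open>The excluded points sit in strips at the two ends of each of the \<open>q\<close>
  periods of length \<open>L / q\<close>. This bounds the set on which \<open>T_pow_low\<close> does
  not apply.\<close>

lemma frac_outside_cover: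
  fixes q :: nat and u v :: real
  assumes q: "q > 0" and uv: "0 \<le> u" "v \<le> 1"
  obtains U where "U \<in> fmeasurable lborel" "measure lborel U \<le> L * (u + (1 - v))"
    "\<And>x::real. \<lbrakk>x \<in> {0..<L}; \<not> (u \<le> frac (q * x / L) \<and> frac (q * x / L) < v)\<rbrakk> \<Longrightarrow> x \<in> U"
proof -
  define w where "w = L / q"
  have w: "w > 0" using q L_pos by (simp add: w_def)
  define I where "I i = {real i * w..real i * w + u * w} \<union> {real i * w + v * w..real i * w + w}" for i
  have I: "I i \<in> fmeasurable lborel" for i
    unfolding I_def by (intro fmeasurable.Un fmeasurable_bounded_borel bounded_closed_interval) auto
  have mI: "measure lborel (I i) \<le> u * w + (1 - v) * w" for i
  proof -
    have "measure lborel (I i) \<le> measure lborel {real i * w..real i * w + u * w}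
        + measure lborel {real i * w + v * w..real i * w + w}"
      unfolding I_def by (intro measure_Un_le) auto
    also have "\<dots> = u * w + (1 - v) * w"
      using uv w by (simp add: algebra_simps mult_le_cancel_right2)
    finally show ?thesis .
  qed
  show ?thesis
  proof (rule that[of "\<Union>i<q. I i"])
    show "(\<Union>i<q. I i) \<in> fmeasurable lborel"
      using I by (intro fmeasurable.finite_UN) auto
    have "measure lborel (\<Union>i<q. I i) \<le> (\<Sum>i<q. measure lborel (I i))"
      using I fmeasurableD by (intro measure_UNION_le) blast+
    also have "\<dots> \<le> (\<Sum>i<q. u * w + (1 - v) * w)"
      by (intro sum_mono mI)
    also have "\<dots> = L * (u + (1 - v))"
      using q by (simp add: w_def field_simps)
    finally show "measure lborel (\<Union>i<q. I i) \<le> L * (u + (1 - v))" .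
    fix x :: real assume x: "x \<in> {0..<L}" and out: "\<not> (u \<le> frac (q * x / L) \<and> frac (q * x / L) < v)"
    define i where "i = nat \<lfloor>q * x / L\<rfloor>"
    have "0 \<le> q * x / L" "q * x / L < q"
      using x L_pos q by (auto simp: field_simps)
    then have i: "real i = of_int \<lfloor>q * x / L\<rfloor>" "i < q"
      by (auto simp: i_def floor_less_iff nat_less_iff)
    have "x = (q * x / L) * w"
      using q L_pos by (simp add: w_def)
    also have "q * x / L = i + frac (q * x / L)"
      by (simp add: i frac_def)
    finally have xi: "x = real i * w + frac (q * x / L) * w"
      by (simp add: distrib_right)
    define f where "f = frac (q * x / L)"
    have f: "0 \<le> f * w" "f * w \<le> 1 * w" "f < u \<Longrightarrow> f * w \<le> u * w" "v \<le> f \<Longrightarrow> v * w \<le> f * w"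
      using w less_imp_le[OF frac_lt_1] by (auto simp: f_def intro!: mult_right_mono)
    have "x \<in> I i"
    proof (cases "f < u")
      case True
      then show ?thesis
        using xi[folded f_def] f(1,3) by (simp add: I_def)
    next
      case False
      then have "v \<le> f"
        using out by (auto simp: f_def)
      then show ?thesis
        using xi[folded f_def] f(2,4) by (simp add: I_def)
    qed
    then show "x \<in> (\<Union>i<q. I i)"
      using i by auto
  qed
qed

definition well_approximable :: bool where
  "well_approximable \<longleftrightarrow> well_approx_pair (\<alpha> / L) (l2 / L)"

text \<open>The constants are chosen in a forced order: \<open>r\<close> from \<eta> to bound the
  density of displaced points, then \<open>e\<close> and \<open>d\<close> from \<open>r\<close> and
  the given sets, and only then the denominator \<open>q\<close>. Outside the displaced points and
  their margins \<open>T ^^ n\<close> is a tiny translation, which almost preserves the sets; on the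
  displaced points it is \<open>T\<close> after that translation, which sends most of
  \<open>C\<close> there into \<open>B\<close>.\<close>

lemma imitate:
  assumes wa: well_approximable
    and F: "finite \<F>" "\<F> \<subseteq> sets iet_measure" and \<eta>: "\<eta> > 0"
    and AB: "A \<in> sets iet_measure" "B \<in> sets iet_measure"
    and pos_AB: "measure iet_measure {x \<in> A. T x \<in> B} > 0"
  shows "\<exists>n\<ge>N. (\<forall>C\<in>\<F>. measure iet_measure (moved (T ^^ n) C) \<le> \<eta>)
      \<and> measure iet_measure {x \<in> A. (T ^^ n) x \<in> B} > 0"
proof -
  define C where "C = {x \<in> A. T x \<in> B}"
  have CM: "C \<in> sets iet_measure"
    unfolding C_def using iet.sets_transfer[OF AB, of 1] by simp
  then have C [measurable]: "C \<in> sets borel" and Csub: "C \<subseteq> {0..<s}"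
    by (auto simp: sets_iet_measure)
  have Cpos: "measure lborel C > 0"
    using pos_AB measure_iet_measure[OF CM] s_pos by (simp add: C_def[symmetric] zero_less_divide_iff)
  have near: "\<exists>d>0. \<forall>t. \<bar>t\<bar> < d \<longrightarrow> measure lborel {x \<in> D. x + t \<notin> D} < e"
    if "D \<in> sets iet_measure" "e > 0" for D e
  proof -
    have "bounded D"
      by (rule bounded_subset[OF bounded_closed_interval[of 0 s]]) (use that in \<open>auto simp: sets_iet_measure\<close>)
    then show ?thesis
      using measure_translate_diff_small[of D e] that by (metis sets_iet_measure)
  qed
  \<comment> \<open>The low points miss at most a proportion \<open>c + 2 * \<delta>\<close>, below
    \<open>2 / r\<close>, of the circle; this choice makes that at most \<eta> * s / 4 in
    measure.\<close>
  obtain r :: nat where r: "r \<ge> 2" "8 * L / (\<eta> * s) \<le> r"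
    using real_arch_simple[of "max 2 (8 * L / (\<eta> * s))"] by auto
  have rpos: "real r > 0" using r by simp
  \<comment> \<open>Covering by \<open>4 * r\<close> shifts loses \<open>4 * r * e\<close>, a
    quarter of the measure of \<open>C\<close>, so \<open>C \<inter> G\<close> has measure at least
    \<open>3 * e\<close>. Losing a further \<open>e\<close> to the final translation still leaves a
    positive measure.\<close>
  define e where "e = measure lborel C / (16 * r)"
  have "e > 0" using Cpos r by (simp add: e_def)
  obtain dC where dC: "dC > 0" "\<And>t. \<bar>t\<bar> < dC \<Longrightarrow> measure lborel {x \<in> C. x + t \<notin> C} < e"
    using near[OF CM \<open>e > 0\<close>] by auto
  have "\<forall>D\<in>\<F>. \<exists>d>0. \<forall>t. \<bar>t\<bar> < d \<longrightarrow> measure lborel {x \<in> D. x + t \<notin> D} < \<eta> * s / 4"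
    using near F \<eta> s_pos by (intro ballI near) auto
  then obtain dF where dF: "\<And>D. D \<in> \<F> \<Longrightarrow> dF D > 0"
      "\<And>D t. D \<in> \<F> \<Longrightarrow> \<bar>t\<bar> < dF D \<Longrightarrow> measure lborel {x \<in> D. x + t \<notin> D} < \<eta> * s / 4"
    by metis
  \<comment> \<open>Shifts below \<open>d\<close> nearly preserve \<open>C\<close> and every set of
    the family, and \<eta> * s / 8 limits the two border strips of width \<open>d\<close> to \<eta>
    * s / 4.\<close>
  define d where "d = Min (insert (\<eta> * s / 8) (insert dC (dF ` \<F>)))"
  have d_le: "d \<le> x" if "x \<in> insert (\<eta> * s / 8) (insert dC (dF ` \<F>))" for x
    unfolding d_def using that F(1) by (intro Min_le) auto
  have d: "d > 0" "d \<le> dC" "d \<le> \<eta> * s / 8" "\<And>D. D \<in> \<F> \<Longrightarrow> d \<le> dF D"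
  proof -
    show "d > 0"
      unfolding d_def using F(1) dC(1) dF(1) \<eta> s_pos by (subst Min_gr_iff) auto
  qed (rule d_le, simp)+
  \<comment> \<open>The first bound makes a whole period \<open>L / q\<close> shorter than
    \<open>d\<close>. The second gives \<open>n \<ge> N\<close>, since \<open>n\<close> is at least
    \<open>q - q * l2 / L\<close>, which equals \<open>q * s / L\<close>.\<close>
  obtain Q :: nat where Q: "2 * L / d \<le> Q" "(N + 1) * L / s \<le> Q"
    using real_arch_simple[of "max (2 * L / d) ((N + 1) * L / s)"] by auto
  define \<delta> where "\<delta> = 1 / (8 * real r)"
  obtain q :: nat and p :: int where q: "q \<ge> Q" "q > 0" "coprime p (int q)"
      and pq: "\<bar>\<alpha> / L - p / q\<bar> < \<delta> / (real q)\<^sup>2"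
      and c': "1 / (2 * real r) < frac (q * (l2 / L))" "frac (q * (l2 / L)) < 1 / real r"
    using wa r(1) unfolding well_approximable_def well_approx_pair_def \<delta>_def by blast
  define c where "c = frac (q * l2 / L)"
  have c: "1 / (2 * real r) < c" "c < 1 / real r"
    using c' by (auto simp: c_def)
  have \<delta>: "0 \<le> \<delta>" "\<delta> \<le> 1" using r by (auto simp: \<delta>_def)
  have r1: "1 / real r \<le> 1 / 2" using r by (simp add: field_simps)
  \<comment> \<open>So \<open>c\<close> lies strictly between \<open>4 * \<delta>\<close> and
    \<open>8 * \<delta>\<close>, and the window of high points, of length
    \<open>c - 2 * \<delta>\<close>, is longer than \<open>1 / (4 * r)\<close>: among
    \<open>4 * r\<close> equally spaced shifts one must hit it.\<close>
  have rr: "1 / (2 * real r) = 4 * \<delta>" "1 / real r = 8 * \<delta>" "1 / (4 * real r) = 2 * \<delta>"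
    by (auto simp: \<delta>_def)
  define \<tau> where "\<tau> = q * \<alpha> - p * L"
  define n where "n = q - nat \<lfloor>q * l2 / L\<rfloor>"
  have pq': "\<bar>\<alpha> / L - p / q\<bar> \<le> \<delta> / real (q\<^sup>2)"
    using pq by simp
  note approx = q(2,3) pq' c_def[symmetric] \<delta>(1)
  have qd: "L / q < d"
  proof -
    have "2 * L / d \<le> q" using Q(1) q(1) by linarith
    then have "2 * L \<le> q * d" using d(1) by (simp add: field_simps)
    then have "L < q * d" using L_pos by linarith
    then show ?thesis using q(2) by (simp add: field_simps)
  qed
  have \<tau>: "\<bar>\<tau>\<bar> < d"
  proof -
    have "\<bar>\<tau>\<bar> \<le> L * \<delta> / q"
      unfolding \<tau>_def by (rule translation_small[OF approx])
    also have "\<dots> \<le> L / q"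
      using \<delta> L_pos by (simp add: divide_right_mono)
    finally show ?thesis using qd by simp
  qed
  have "n \<ge> N"
  proof -
    have "(N + 1) * L / s \<le> q" using Q(2) q(1) by linarith
    then have "N + 1 \<le> q * (s / L)"
      using L_pos s_pos by (simp add: field_simps)
    also have "\<dots> = q - q * l2 / L"
      using L_pos by (simp add: L_eq field_simps)
    finally have "q * l2 / L \<le> real q - N - 1"
      by simp
    then have "\<lfloor>q * l2 / L\<rfloor> \<le> int q - int N - 1"
      by (metis (mono_tags) of_int_1 of_int_diff of_int_of_nat_eq floor_of_int floor_mono)
    moreover have "\<lfloor>q * l2 / L\<rfloor> \<ge> 0"
      using pos L_pos by simp
    ultimately show ?thesis
      unfolding n_def by linarith
  qed
  moreover have "measure iet_measure (moved (T ^^ n) D) \<le> \<eta>" if D: "D \<in> \<F>" for D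
  proof -
    have DM: "D \<in> sets iet_measure" using D F(2) by blast
    then have [measurable]: "D \<in> sets borel" and Dsub: "D \<subseteq> {0..<s}"
      by (auto simp: sets_iet_measure)
    obtain U where U: "U \<in> fmeasurable lborel" "measure lborel U \<le> L * (\<delta> + (1 - (1 - c - \<delta>)))"
      "\<And>x::real. \<lbrakk>x \<in> {0..<L}; \<not> (\<delta> \<le> frac (q * x / L) \<and> frac (q * x / L) < 1 - c - \<delta>)\<rbrakk> \<Longrightarrow> x \<in> U"
      using frac_outside_cover[of q \<delta> "1 - c - \<delta>"] q(2) \<delta> c rr by auto
    \<comment> \<open>Near the two ends the translation by \<tau> may leave \<open>[0, s)\<close>,
      and then \<open>T_pow_low\<close> says nothing.\<close>
    define V where "V = {0..d} \<union> {s - d..s}"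
    define W where "W = {x \<in> D. x + \<tau> \<notin> D}"
    have V: "V \<in> fmeasurable lborel"
      unfolding V_def by (intro fmeasurable.Un fmeasurable_bounded_borel bounded_closed_interval) auto
    have W: "W \<in> fmeasurable lborel"
      using Dsub by (intro fmeasurable_subset_space) (auto simp: W_def)
    have bor: "U \<in> sets borel" "V \<in> sets borel" "W \<in> sets borel"
      using U(1) V W fmeasurableD by fastforce+
    have MM: "moved (T ^^ n) D \<in> sets iet_measure"
      using DM by (rule iet.sets_moved)
    have "moved (T ^^ n) D \<subseteq> U \<union> (V \<union> W)"
    proof
      fix x assume x: "x \<in> moved (T ^^ n) D"
      show "x \<in> U \<union> (V \<union> W)"
      proof (rule ccontr)
        assume out: "x \<notin> U \<union> (V \<union> W)"
        have xD: "x \<in> D" "(T ^^ n) x \<notin> D" using x by (auto simp: moved_def)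
        then have "x \<in> {0..<s}" using Dsub by blast
        moreover have "x + \<tau> \<in> {0..<s}"
          using out \<open>x \<in> {0..<s}\<close> \<tau> by (auto simp: V_def)
        moreover have "\<delta> \<le> frac (q * x / L) \<and> frac (q * x / L) < 1 - c - \<delta>"
          using out U(3)[of x] \<open>x \<in> {0..<s}\<close> s_less_L by auto
        ultimately have "(T ^^ n) x = x + \<tau>"
          unfolding n_def \<tau>_def by (intro T_pow_low[OF approx]) auto
        then show False
          using out xD by (auto simp: W_def)
      qed
    qed
    then have "measure lborel (moved (T ^^ n) D) \<le> measure lborel (U \<union> (V \<union> W))"
      using U V W MM by (intro measure_mono_fmeasurable fmeasurable.Un) (auto simp: sets_iet_measure)
    also have "\<dots> \<le> measure lborel U + measure lborel (V \<union> W)"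
      using bor by (intro measure_Un_le) auto
    also have "measure lborel (V \<union> W) \<le> measure lborel V + measure lborel W"
      using bor by (intro measure_Un_le) auto
    also have "measure lborel V \<le> measure lborel {0..d} + measure lborel {s - d..s}"
      unfolding V_def by (intro measure_Un_le) auto
    also have "\<dots> = 2 * d"
      using d(1) by simp
    also have "measure lborel W \<le> \<eta> * s / 4"
      using dF(2)[OF D, of \<tau>] \<tau> d(4)[OF D] unfolding W_def by simp
    also have "measure lborel U \<le> \<eta> * s / 4"
    proof -
      have "L * (\<delta> + (1 - (1 - c - \<delta>))) \<le> L * (2 / r)"
        using c rr \<delta> L_pos by (intro mult_left_mono) auto
      also have "\<dots> \<le> \<eta> * s / 4"
        using r(2) rpos \<eta> s_pos by (simp add: field_simps)
      finally show ?thesis using U(2) by simp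
    qed
    finally have "measure lborel (moved (T ^^ n) D) \<le> \<eta> * s"
      using d(1,3) by linarith
    then show ?thesis
      using s_pos by (simp add: measure_iet_measure[OF MM] pos_divide_le_eq)
  qed
  moreover have "measure iet_measure {x \<in> A. (T ^^ n) x \<in> B} > 0"
  proof -
    define G where "G = {x::real. 1 - c + \<delta> \<le> frac (q * x / L) \<and> frac (q * x / L) < 1 - \<delta>}"
    \<comment> \<open>Shifting \<open>x\<close> by \<open>h\<close> changes \<open>q * x / L\<close>
      by \<open>1 / (4 * r)\<close>, so all the shifts used stay within one period.\<close>
    define h where "h = L / q / (4 * r)"
    define P where "P = {x \<in> C. x + \<tau> \<notin> C}"
    have G: "G \<in> sets borel"
      unfolding G_def by measurable
    have "measure lborel C \<le> real (4 * r) * (e + measure lborel (C \<inter> G))"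
    proof (rule measure_Int_ge_of_cover[OF C G])
      show "bounded C"
        by (rule bounded_subset[OF bounded_closed_interval[of 0 s]]) (use Csub in auto)
      fix x :: real
      have "\<exists>j<4 * r. 1 - c + \<delta> \<le> frac (q * x / L - j / (4 * r)) \<and>
          frac (q * x / L - j / (4 * r)) < 1 - c + \<delta> + (c - 2 * \<delta>)"
        using exists_shift_frac_mem[of "4 * r" "1 - c + \<delta>" "c - 2 * \<delta>" "q * x / L"] r(1) c rr r1 \<delta> by simp
      moreover have "q * (x - j * h) / L = q * x / L - j / (4 * r)" for j :: nat
        using q(2) L_pos by (simp add: h_def field_simps)
      ultimately show "\<exists>j<4 * r. x - j * h \<in> G"
        by (auto simp: G_def)
    next
      fix j assume j: "j < 4 * r"
      have "\<bar>- (j * h)\<bar> = L / q * (j / (4 * r))"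
        using L_pos by (simp add: h_def)
      also have "\<dots> \<le> L / q * 1"
        using L_pos j rpos by (intro mult_left_mono) auto
      finally have "\<bar>- (j * h)\<bar> < dC"
        using qd d(2) by simp
      then show "measure lborel {x \<in> C. x - j * h \<notin> C} \<le> e"
        using dC(2)[of "- (j * h)"] by simp
    qed
    also have "\<dots> = measure lborel C / 4 + 4 * r * measure lborel (C \<inter> G)"
      using rpos by (simp add: e_def distrib_left)
    finally have "4 * r * (2 * e) < 4 * r * measure lborel (C \<inter> G)"
      using rpos Cpos by (simp add: e_def)
    then have CG: "2 * e < measure lborel (C \<inter> G)"
      using rpos by simp
    let ?H = "{x \<in> A. (T ^^ n) x \<in> B}"
    have HM: "?H \<in> sets iet_measure"
      using AB by (rule iet.sets_transfer)
    have "C \<inter> G \<subseteq> ?H \<union> P"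
    proof
      fix x assume x: "x \<in> C \<inter> G"
      show "x \<in> ?H \<union> P"
      \<comment> \<open>Membership of the translated point in \<open>C\<close> is what is needed,
        because \<open>T\<close> is applied after the translation.\<close>
      proof (cases "x + \<tau> \<in> C")
        case True
        then have "(T ^^ n) x = T (x + \<tau>)"
          unfolding n_def \<tau>_def using x Csub
          by (intro T_pow_high[OF approx]) (auto simp: G_def)
        then show ?thesis
          using x True by (auto simp: C_def)
      next
        case False
        then show ?thesis using x by (auto simp: P_def)
      qed
    qed
    then have "measure lborel (C \<inter> G) \<le> measure lborel (?H \<union> P)"
      using HM Csub G
      by (intro measure_mono_fmeasurable fmeasurable.Un fmeasurable_subset_space)
        (auto simp: P_def sets_iet_measure)
    also have "\<dots> \<le> measure lborel ?H + measure lborel P"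
      using HM by (intro measure_Un_le) (auto simp: P_def sets_iet_measure)
    also have "measure lborel P < e"
      using dC(2)[of \<tau>] \<tau> d(2) by (simp add: P_def)
    finally have "measure lborel ?H > 0"
      using CG \<open>e > 0\<close> by simp
    then show ?thesis
      using measure_iet_measure[OF HM] s_pos by simp
  qed
  ultimately show ?thesis
    by blast
qed

text \<open>Stated for any \<open>S\<close> that agrees with \<open>T\<close> on
  \<open>[0, s)\<close>, because the exchange as defined and the explicit \<open>T\<close> are
  compared only there.\<close>

lemma whirly_of_well_approximable:
  assumes wa: well_approximable and gen: "generating_family iet_measure E"
    and S: "\<And>x. x \<in> {0..<s} \<Longrightarrow> S x = T x"
  shows "whirly iet_measure E S"
proof -
  have pow: "(S ^^ n) x = (T ^^ n) x" if "x \<in> {0..<s}" for n x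
    using that by (induction n) (use S T_pow_mem in auto)
  have eq: "{x \<in> A. (S ^^ n) x \<in> B} = {x \<in> A. (T ^^ n) x \<in> B}"
      "moved (S ^^ n) A = moved (T ^^ n) A" if "A \<in> sets iet_measure" for n A B
    using pow that by (auto simp: moved_def sets_iet_measure subset_eq)
  have eq1: "{x \<in> A. S x \<in> B} = {x \<in> A. T x \<in> B}" if "A \<in> sets iet_measure" for A B
    using eq(1)[OF that, of 1] by simp
  have "S \<in> Aut iet_measure"
    using T_in_Aut S by (subst Aut_cong[where S'=T]) auto
  then interpret S: automorphism iet_measure S
    using prob_space_iet_measure by (simp add: automorphism_def automorphism_axioms_def)
  show ?thesis
    using gen
  proof (rule S.whirlyI)
    fix A B
    assume "A \<in> sets iet_measure" "B \<in> sets iet_measure" "measure iet_measure A > 0" "measure iet_measure B > 0"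
    then show "\<exists>m. measure iet_measure {x \<in> A. (S ^^ m) x \<in> B} > 0"
      using ergodic[of A B] wa by (simp add: eq well_approximable_def well_approx_pair_def)
  next
    fix \<F> :: "real set set" and \<eta> :: real and N :: nat and A B
    assume *: "finite \<F>" "\<F> \<subseteq> sets iet_measure" "\<eta> > 0" "A \<in> sets iet_measure" "B \<in> sets iet_measure"
      "measure iet_measure {x \<in> A. S x \<in> B} > 0"
    then obtain n where n: "n \<ge> N" "\<forall>C\<in>\<F>. measure iet_measure (moved (T ^^ n) C) \<le> \<eta>"
        "measure iet_measure {x \<in> A. (T ^^ n) x \<in> B} > 0"
      using imitate[OF wa *(1-5)] eq1[OF *(4)] by metis
    have "moved (S ^^ n) C = moved (T ^^ n) C" if "C \<in> \<F>" for C
      using *(2) that by (intro eq) blast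
    then show "\<exists>n\<ge>N. (\<forall>C\<in>\<F>. measure iet_measure (moved (S ^^ n) C) \<le> \<eta>)
        \<and> measure iet_measure {x \<in> A. (S ^^ n) x \<in> B} > 0"
      using n *(4) by (intro exI[of _ n]) (simp add: eq)
  qed
qed

end

section \<open>Almost every length vector\<close>

text \<open>A polynomial map that recovers a length vector from the ratios \<alpha> / L,
  \<open>l2 / L\<close> and the circumference \<open>L\<close>.\<close>

definition lambda_of :: "(real \<times> real) \<times> real \<Rightarrow> real ^ 3" where
  "lambda_of z = (snd z * (1 - fst (fst z) - snd (fst z))) *\<^sub>R axis 1 1
     + (snd z * snd (fst z)) *\<^sub>R axis 2 1
     + (snd z * (fst (fst z) - snd (fst z))) *\<^sub>R axis 3 1"

lemma lambda_of_nth: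
  "lambda_of z $ 1 = snd z - snd z * fst (fst z) - snd z * snd (fst z)"
  "lambda_of z $ 2 = snd z * snd (fst z)"
  "lambda_of z $ 3 = snd z * fst (fst z) - snd z * snd (fst z)"
  by (simp_all add: lambda_of_def axis_def right_diff_distrib)

lemma lambda_of_differentiable: "lambda_of differentiable_on S"
  unfolding differentiable_on_def differentiable_def lambda_of_def[abs_def]
  by (intro ballI exI) (rule derivative_eq_intros refl)+

lemma Lambda3_iff: "l \<in> Lambda3 \<longleftrightarrow> l $ 1 > 0 \<and> l $ 2 > 0 \<and> l $ 3 > 0"
proof -
  have "{1..3} = {1, 2, 3 :: nat}"
    by auto
  then show ?thesis
    by (simp add: Lambda3_def len_def)
qed

text \<open>A differentiable map between spaces of equal dimension sends null sets to null sets, so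
  the bad triples yield only a null set of length vectors.\<close>

lemma AE_well_approx_pair_lambda:
  "AE l in (lebesgue :: (real ^ 3) measure). l \<in> Lambda3 \<longrightarrow>
     well_approx_pair ((l $ 2 + l $ 3) / (l $ 1 + 2 * l $ 2 + l $ 3)) (l $ 2 / (l $ 1 + 2 * l $ 2 + l $ 3))"
proof -
  let ?N = "{z :: (real \<times> real) \<times> real. \<not> well_approx_pair (fst (fst z)) (snd (fst z))}"
  have "negligible (lambda_of ` ?N)"
    by (rule negligible_differentiable_image_negligible[OF _ negligible_not_well_approx_pair
      lambda_of_differentiable]) simp
  then have "AE l in lebesgue. l \<notin> lambda_of ` ?N"
    by (intro AE_not_in) (simp add: negligible_iff_null_sets)
  then show ?thesis
  proof eventually_elim
    case (elim l)
    show ?case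
    proof
      assume l: "l \<in> Lambda3"
      define L where "L = l $ 1 + 2 * l $ 2 + l $ 3"
      have "L > 0"
        using l by (simp add: Lambda3_iff L_def add_pos_pos)
      then have "lambda_of (((l $ 2 + l $ 3) / L, l $ 2 / L), L) = l"
        unfolding vec_eq_iff forall_3 lambda_of_nth by (simp add: L_def)
      then have "(((l $ 2 + l $ 3) / L, l $ 2 / L), L) \<notin> ?N"
        using elim imageI[of "(((l $ 2 + l $ 3) / L, l $ 2 / L), L)" ?N lambda_of] by auto
      then show "well_approx_pair ((l $ 2 + l $ 3) / (l $ 1 + 2 * l $ 2 + l $ 3)) (l $ 2 / (l $ 1 + 2 * l $ 2 + l $ 3))"
        unfolding L_def by simp
    qed
  qed
qed

lemma iet_eq:
  fixes p :: "nat \<Rightarrow> nat"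
  assumes p: "\<forall>j\<in>{1..3}. p j = 4 - j" and l: "l \<in> Lambda3"
    and x: "x \<in> {0..<l $ 1 + l $ 2 + l $ 3}"
  shows "iet l p x = (if x < l $ 1 then x + l $ 2 + l $ 3
    else if x < l $ 1 + l $ 2 then x + l $ 3 - l $ 1 else x - l $ 1 - l $ 2)"
proof -
  have I: "{1..3} = {1, 2, 3 :: nat}" "{1..2} = {1, 2 :: nat}"
    by auto
  have sum12: "(\<Sum>j=Suc 0..2. f j) = f 1 + f 2" for f :: "nat \<Rightarrow> real"
    unfolding One_nat_def[symmetric] I by simp
  have pos: "l $ 1 > 0" "l $ 2 > 0" "l $ 3 > 0"
    using l by (auto simp: Lambda3_iff)
  have beta: "beta l 0 = 0" "beta l 1 = l $ 1" "beta l 2 = l $ 1 + l $ 2" "beta l 3 = l $ 1 + l $ 2 + l $ 3"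
    unfolding beta_def len_def I by simp_all
  have p': "p 1 = 3" "p 2 = 2" "p 3 = 1"
    using p by auto
  have inj: "inj_on p {1..3}"
    using p' unfolding I by (simp add: inj_on_def)
  have inv: "inv_into {1..3} p 1 = 3" "inv_into {1..3} p 2 = 2" "inv_into {1..3} p 3 = 1"
    by (rule inv_into_f_eq[OF inj _ p'(3)] inv_into_f_eq[OF inj _ p'(2)] inv_into_f_eq[OF inj _ p'(1)], simp)+
  define Q where "Q i \<longleftrightarrow> i \<in> {1..3} \<and> x \<in> {beta l (i - 1)..<beta l i}" for i :: nat
  have Q: "Q i \<longleftrightarrow> (i = 1 \<and> 0 \<le> x \<and> x < l $ 1) \<or> (i = 2 \<and> l $ 1 \<le> x \<and> x < l $ 1 + l $ 2)
      \<or> (i = 3 \<and> l $ 1 + l $ 2 \<le> x \<and> x < l $ 1 + l $ 2 + l $ 3)" for i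
    unfolding Q_def I using beta by auto
  have iet: "iet l p x = x - beta l ((THE i. Q i) - 1) + (\<Sum>j=1..p (THE i. Q i) - 1. len l (inv_into {1..3} p j))"
    by (simp add: iet_def Q_def Let_def)
  consider "x < l $ 1" | "l $ 1 \<le> x" "x < l $ 1 + l $ 2" | "l $ 1 + l $ 2 \<le> x"
    by linarith
  then show ?thesis
  proof cases
    case 1
    then have "(THE i. Q i) = 1"
      using x pos by (intro the_equality) (auto simp: Q)
    then show ?thesis
      unfolding iet using 1 pos p' beta inv by (simp add: sum12 len_def)
  next
    case 2
    then have "(THE i. Q i) = 2"
      using x pos by (intro the_equality) (auto simp: Q)
    then show ?thesis
      unfolding iet using 2 pos p' beta inv by (simp add: len_def)
  next
    case 3
    then have "(THE i. Q i) = 3"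
      using x pos by (intro the_equality) (auto simp: Q)
    then show ?thesis
      unfolding iet using 3 pos p' beta inv by simp
  qed
qed

theorem theorem1p13:
  fixes p :: "nat \<Rightarrow> nat"
  assumes "\<forall>j\<in>{1..3}. p j = 4 - j"
  shows "AE l in (lebesgue :: (real ^ 3) measure). l \<in> Lambda3 \<longrightarrow>
           (\<forall>E. generating_family (iet_space l) E \<longrightarrow>
                whirly (iet_space l) E (iet l p))"
  using AE_well_approx_pair_lambda
proof eventually_elim
  case (elim l)
  show ?case
  proof (intro impI allI)
    \<comment> \<open>The exceptional null set comes from the Diophantine condition on
      \<open>l\<close> alone, so one null set serves all generating families.\<close>
    fix E assume l: "l \<in> Lambda3" and gen: "generating_family (iet_space l) E"
    have I: "{1..3} = {1, 2, 3 :: nat}"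
      by auto
    interpret iet3 "l $ 1" "l $ 2" "l $ 3"
      using l by unfold_locales (auto simp: Lambda3_iff)
    have "iet_space l = iet_measure"
      unfolding iet_space_def iet_measure_def total_len_def len_def I s_def by (simp add: Let_def add.assoc)
    moreover have "well_approximable"
      using elim l by (simp add: well_approximable_def well_approx_pair_def \<alpha>_def L_def)
    moreover have "iet l p x = T x" if "x \<in> {0..<s}" for x
      using iet_eq[OF assms l] that by (simp add: T_def s_def)
    ultimately show "whirly (iet_space l) E (iet l p)"
      using whirly_of_well_approximable[of E "iet l p"] gen by simp
  qed
qed

end
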